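(* Consider the Regularized Composite Tensor Method $x_0\in\operatorname{dom}h$, $x_{k+1}=T_H(x_k)$ for $k\ge 0$, with $H\ge pL_p$. Assume $F=f+h$ is uniformly convex of degree $q\ge 2$ with constant $\sigma_q>0$, and let $F^*=\min_{x\in\operatorname{dom}h}F(x)$. Then for every $k\ge 0$, $$F(x_{k+1})-F^*\le (q-1)\,q^{\frac{p-q+1}{q-1}}\Big(\frac{1}{\sigma_q}\Big)^{\frac{p+1}{q-1}}\Big(\frac{L_p+H}{p!}\Big)^{\frac{q}{q-1}}\big[F(x_k)-F^*\big]^{\frac{p}{q-1}}.$$
   Context: $\mathbb{E}$ is a finite-dimensional real vector space with dual $\mathbb{E}^*$; $B:\mathbb{E}\to\mathbb{E}^*$ is a fixed self-adjoint positive-definite operator, $\|x\|=\langle Bx,x\rangle^{1/2}$, $\|g\|_*=\langle g,B^{-1}g\rangle^{1/2}$. Let $p\ge 2$ be an integer, $h:\mathbb{E}\to\mathbb{R}\cup\{+\infty\}$ proper closed convex, and $f$ convex and $p$ times differentiable on an open convex set containing $\operatorname{dom}h$, with $\|D^pf(x)-D^pf(y)\|\le L_p\|x-y\|$ for $x,y\in\operatorname{dom}h$, $0<L_p<\infty$, where for a symmetric $p$-linear form $\|A\|=\max_{\|u\|\le1}|A[u]^p|$. $F=f+h$. Taylor polynomial: $\Omega_p(f,x;y)=f(x)+\sum_{k=1}^p\frac1{k!}D^kf(x)[y-x]^k$. For $x\in\operatorname{dom}h$, $T_H(x)=\arg\min_{y\in\mathbb{E}}\{\Omega_p(f,x;y)+\frac{H}{(p+1)!}\|y-x\|^{p+1}+h(y)\}$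 (for $H\ge pL_p$ this subproblem is convex). Uniform convexity of degree $q$ with constant $\sigma_q$ means: $\langle G_x-G_y,x-y\rangle\ge\sigma_q\|x-y\|^q$ for all $x,y\in\operatorname{dom}h$, $G_x\in\partial F(x)$, $G_y\in\partial F(y)$. *)

theory Defs
  imports "HOL-Analysis.Analysis"
begin

text \<open>Euclidean norm induced by a self-adjoint positive definite operator B
  (the dual space is identified with the space via the inner product).\<close>
definition normB :: "('a::euclidean_space \<Rightarrow> 'a) \<Rightarrow> 'a \<Rightarrow> real" where
  "normB B x = sqrt (B x \<bullet> x)"

definition pos_def_selfadjoint :: "('a::euclidean_space \<Rightarrow> 'a) \<Rightarrow> bool" where
  "pos_def_selfadjoint B \<longleftrightarrow> linear B \<and> (\<forall>x y. B x \<bullet> y = x \<bullet> B y) \<and> (\<forall>x. x \<noteq> 0 \<longrightarrow> B x \<bullet> x > 0)"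

text \<open>Tower of Frechet derivatives up to order p on U: D k x [u1,...,uk] is
  D^k f(x)[u1,...,uk]; D (k+1) x is the Frechet derivative of x \<mapsto> D k x.\<close>
definition deriv_tower ::
  "('a::real_normed_vector \<Rightarrow> real) \<Rightarrow> nat \<Rightarrow> (nat \<Rightarrow> 'a \<Rightarrow> 'a list \<Rightarrow> real) \<Rightarrow> 'a set \<Rightarrow> bool" where
  "deriv_tower f p D U \<longleftrightarrow>
     (\<forall>x\<in>U. D 0 x [] = f x) \<and>
     (\<forall>k<p. \<forall>x\<in>U. \<forall>us. length us = k \<longrightarrow>
         ((\<lambda>y. D k y us) has_derivative (\<lambda>v. D (Suc k) x (v # us))) (at x))"

definition taylor_poly ::
  "('a::real_normed_vector \<Rightarrow> real) \<Rightarrow> (nat \<Rightarrow> 'a \<Rightarrow> 'a list \<Rightarrow> real) \<Rightarrow> nat \<Rightarrow> 'a \<Rightarrow> 'a \<Rightarrow> real" where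
  "taylor_poly f D p x y = f x + (\<Sum>k=1..p. D k x (replicate k (y - x)) / fact k)"

definition edom :: "('a \<Rightarrow> ereal) \<Rightarrow> 'a set" where
  "edom h = {x. h x < \<infinity>}"

definition proper_closed_convex :: "('a::real_normed_vector \<Rightarrow> ereal) \<Rightarrow> bool" where
  "proper_closed_convex h \<longleftrightarrow>
     (\<forall>x. h x \<noteq> -\<infinity>) \<and> edom h \<noteq> {} \<and>
     (\<forall>x y t. 0 \<le> t \<and> t \<le> 1 \<longrightarrow>
        h ((1 - t) *\<^sub>R x + t *\<^sub>R y) \<le> ereal (1 - t) * h x + ereal t * h y) \<and>
     closed {(x, c::real). h x \<le> ereal c}"

definition subdiff :: "('a::real_inner \<Rightarrow> ereal) \<Rightarrow> 'a \<Rightarrow> 'a set" where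
  "subdiff F x = {g. F x < \<infinity> \<and> (\<forall>y. F y \<ge> F x + ereal (g \<bullet> (y - x)))}"

end

theory Submission
  imports Defs
begin

text \<open>Write \<open>X = x k\<close>, \<open>T = x (k + 1)\<close>, \<open>r = \<parallel>T - X\<parallel>\<close>, and let \<open>m\<close> be the regularized Taylor model of \<open>f\<close>
  at \<open>X\<close>. Since \<open>T\<close> minimizes \<open>m + h\<close>, the vector \<open>G = f'(T) - m'(T)\<close> is a subgradient of \<open>F\<close> at \<open>T\<close>.
  Taylor's theorem for \<open>f'\<close> gives \<open>\<parallel>f'(T) - \<Omega>'(T)\<parallel> \<le> L r^p / p!\<close>, hence
  \<open>\<parallel>G\<parallel> \<le> (L + H) r^p / p!\<close>, and also \<open>\<langle>G, X - T\<rangle> \<ge> 0\<close> because \<open>H \<ge> L\<close>. Uniform monotonicity of the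
  subgradients integrates to \<open>F y \<ge> F T + \<langle>G, y - T\<rangle> + (\<sigma> / q) \<parallel>y - T\<parallel>^q\<close>. At \<open>y = X\<close> this bounds \<open>r^q\<close> by
  \<open>(q / \<sigma>) (F X - F*)\<close>; minimizing the right-hand side over \<open>y\<close> (Young's inequality) bounds
  \<open>F T - F*\<close> by a multiple of \<open>\<parallel>G\<parallel>\<close> to the power \<open>q / (q - 1)\<close>.

  The Lipschitz hypothesis controls \<open>D\<^sup>p f\<close> only on the diagonal, whereas the bound on \<open>\<parallel>G\<parallel>\<close> needs the mixed
  values \<open>A[v, u, \<dots>, u]\<close> of a symmetric form. That these obey the same bound with no loss of constant
  is Banach's theorem, obtained here from a Riesz-type quadrature formula with Fejer weights.\<close>

subsection \<open>Symmetry of higher derivatives\<close>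

text \<open>The mean value theorem is applied in the direction \<open>v\<close> to the increment of
  \<open>f\<close> by \<open>t *\<^sub>R w\<close>. Expanding the two resulting values of
  \<open>g _ v\<close> to first order at \<open>a\<close>, the contributions of
  \<open>A (z *\<^sub>R v)\<close> cancel and \<open>t * A w\<close> remains.\<close>

lemma second_difference_bound:
  fixes f :: "'a::real_normed_vector \<Rightarrow> real"
  assumes "open U" "a \<in> U"
    and g: "\<And>y. y \<in> U \<Longrightarrow> (f has_derivative g y) (at y)"
    and A: "((\<lambda>y. g y v) has_derivative A) (at a)"
    and "e > 0"
  shows "\<exists>d>0. \<forall>t. 0 < t \<and> t < d \<longrightarrow>
    \<bar>f (a + t *\<^sub>R v + t *\<^sub>R w) - f (a + t *\<^sub>R v) - f (a + t *\<^sub>R w) + f a - t\<^sup>2 * A w\<bar> \<le> e * t\<^sup>2"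
proof -
  \<comment> \<open>The two expansion errors below are at most
    \<open>e / K * t * (norm v + norm w)\<close> and \<open>e / K * t * norm v\<close>; their sum is
    at most \<open>e * t\<close>. The summand 1 keeps \<open>K\<close> positive.\<close>
  define K where "K = 2 * norm v + norm w + 1"
  have K: "K > 0" unfolding K_def by (smt (verit) norm_ge_zero)
  have linA: "linear A" using A has_derivative_linear by blast
  have "e / K > 0" using K \<open>e > 0\<close> by simp
  with A obtain d0 where d0: "d0 > 0"
    and bd: "\<And>y. norm (y - a) < d0 \<Longrightarrow> \<bar>g y v - g a v - A (y - a)\<bar> \<le> e / K * norm (y - a)"
    unfolding has_derivative_at_alt by (metis real_norm_def)
  obtain r where r: "r > 0" "ball a r \<subseteq> U" using assms open_contains_ball by blast
  define d where "d = min r d0 / K"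
  have "d > 0" using r d0 K by (simp add: d_def)
  moreover have "\<bar>f (a + t *\<^sub>R v + t *\<^sub>R w) - f (a + t *\<^sub>R v) - f (a + t *\<^sub>R w) + f a - t\<^sup>2 * A w\<bar> \<le> e * t\<^sup>2"
    if t: "0 < t" "t < d" for t
  proof -
    have tK: "t * K < r" "t * K < d0"
      using t K by (auto simp: d_def field_simps)
    have nrm: "norm (s *\<^sub>R v + c *\<^sub>R w) \<le> t * (norm v + norm w)" if "0 \<le> s" "s \<le> t" "0 \<le> c" "c \<le> t" for s c
    proof -
      have "norm (s *\<^sub>R v + c *\<^sub>R w) \<le> s * norm v + c * norm w"
        using norm_triangle_ineq[of "s *\<^sub>R v" "c *\<^sub>R w"] that by simp
      also have "\<dots> \<le> t * norm v + t * norm w"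
        using that by (intro add_mono mult_right_mono) auto
      finally show ?thesis by (simp add: algebra_simps)
    qed
    have le: "t * (norm v + norm w) \<le> t * K"
      using t by (intro mult_left_mono) (auto simp: K_def)
    have inU: "a + s *\<^sub>R v + c *\<^sub>R w \<in> U" if "0 \<le> s" "s \<le> t" "0 \<le> c" "c \<le> t" for s c
    proof -
      have "dist a (a + s *\<^sub>R v + c *\<^sub>R w) = norm (s *\<^sub>R v + c *\<^sub>R w)"
        by (simp add: dist_norm norm_minus_commute algebra_simps)
      then show ?thesis using nrm[OF that] le tK r by auto
    qed
    define G where "G s = f (a + s *\<^sub>R v + t *\<^sub>R w) - f (a + s *\<^sub>R v)" for s
    have derf: "((\<lambda>s. f (a + s *\<^sub>R v + c *\<^sub>R w)) has_real_derivative g (a + s *\<^sub>R v + c *\<^sub>R w) v) (at s)"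
      if "0 \<le> s" "s \<le> t" "0 \<le> c" "c \<le> t" for s c
    proof -
      have "((\<lambda>s. f (a + s *\<^sub>R v + c *\<^sub>R w)) has_derivative (\<lambda>h. g (a + s *\<^sub>R v + c *\<^sub>R w) (h *\<^sub>R v))) (at s)"
        by (rule has_derivative_compose[of "\<lambda>s. a + s *\<^sub>R v + c *\<^sub>R w" "\<lambda>h. h *\<^sub>R v" s UNIV f])
          (auto intro!: derivative_eq_intros g inU that)
      moreover have "linear (g (a + s *\<^sub>R v + c *\<^sub>R w))"
        using g[OF inU[OF that]] has_derivative_linear by blast
      ultimately show ?thesis
        by (simp add: has_field_derivative_def linear_cmul mult.commute[of _ "g _ v"])
    qed
    have "\<exists>z>0. z < t \<and> G t - G 0 = (t - 0) * (g (a + z *\<^sub>R v + t *\<^sub>R w) v - g (a + z *\<^sub>R v) v)"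
    proof (rule MVT2[OF \<open>0 < t\<close>])
      fix s assume "0 \<le> s" "s \<le> t"
      then show "(G has_real_derivative g (a + s *\<^sub>R v + t *\<^sub>R w) v - g (a + s *\<^sub>R v) v) (at s)"
        unfolding G_def using derf[of s t] derf[of s 0] t by (auto intro!: DERIV_diff)
    qed
    then obtain z where z: "0 < z" "z < t"
      and Gz: "G t - G 0 = t * (g (a + z *\<^sub>R v + t *\<^sub>R w) v - g (a + z *\<^sub>R v) v)" by auto
    have 1: "\<bar>g (a + z *\<^sub>R v + t *\<^sub>R w) v - g a v - A (z *\<^sub>R v + t *\<^sub>R w)\<bar> \<le> e / K * (t * (norm v + norm w))"
    proof -
      have "\<bar>g (a + z *\<^sub>R v + t *\<^sub>R w) v - g a v - A (z *\<^sub>R v + t *\<^sub>R w)\<bar> \<le> e / K * norm (z *\<^sub>R v + t *\<^sub>R w)"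
        using bd[of "a + z *\<^sub>R v + t *\<^sub>R w"] nrm[of z t] z t le tK by (simp add: algebra_simps)
      also have "\<dots> \<le> e / K * (t * (norm v + norm w))"
        using nrm[of z t] z t \<open>e / K > 0\<close> by (intro mult_left_mono) auto
      finally show ?thesis .
    qed
    have 2: "\<bar>g (a + z *\<^sub>R v) v - g a v - A (z *\<^sub>R v)\<bar> \<le> e / K * (t * norm v)"
    proof -
      have "norm (z *\<^sub>R v) \<le> t * norm v" using z by (simp add: mult_right_mono)
      moreover have "t * norm v \<le> t * K" using t by (intro mult_left_mono) (auto simp: K_def)
      ultimately have "norm (z *\<^sub>R v) < d0" using tK by linarith
      then have "\<bar>g (a + z *\<^sub>R v) v - g a v - A (z *\<^sub>R v)\<bar> \<le> e / K * norm (z *\<^sub>R v)"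
        using bd[of "a + z *\<^sub>R v"] by simp
      also have "\<dots> \<le> e / K * (t * norm v)"
        using \<open>norm (z *\<^sub>R v) \<le> t * norm v\<close> \<open>e / K > 0\<close> by (intro mult_left_mono) auto
      finally show ?thesis .
    qed
    have "A (z *\<^sub>R v + t *\<^sub>R w) = A (z *\<^sub>R v) + t * A w"
      using linA by (simp add: linear_add linear_cmul)
    with 1 2 have "\<bar>(g (a + z *\<^sub>R v + t *\<^sub>R w) v - g (a + z *\<^sub>R v) v) - t * A w\<bar>
        \<le> e / K * (t * (norm v + norm w)) + e / K * (t * norm v)"
      by linarith
    also have "\<dots> = e * t * ((2 * norm v + norm w) / K)"
    proof -
      have "x / K * (t * (b + c)) + x / K * (t * b) = x * t * ((2 * b + c) / K)" for x b c :: real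
        using K by (simp add: divide_simps) (simp add: algebra_simps)
      then show ?thesis .
    qed
    also have "2 * norm v + norm w = K - 1" by (simp add: K_def)
    also have "e * t * ((K - 1) / K) \<le> e * t * 1"
      using K t \<open>e > 0\<close> by (intro mult_left_mono) auto
    finally have "t * \<bar>(g (a + z *\<^sub>R v + t *\<^sub>R w) v - g (a + z *\<^sub>R v) v) - t * A w\<bar> \<le> t * (e * t)"
      using t by (intro mult_left_mono) auto
    moreover have "f (a + t *\<^sub>R v + t *\<^sub>R w) - f (a + t *\<^sub>R v) - f (a + t *\<^sub>R w) + f a - t\<^sup>2 * A w
       = t * ((g (a + z *\<^sub>R v + t *\<^sub>R w) v - g (a + z *\<^sub>R v) v) - t * A w)"
      using Gz by (simp add: G_def power2_eq_square algebra_simps)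
    ultimately show ?thesis
      using t by (simp add: abs_mult power2_eq_square mult_ac)
  qed
  ultimately show ?thesis by blast
qed

text \<open>The second difference is symmetric in \<open>v\<close> and \<open>w\<close>, so
  \<open>t\<^sup>2 * A w\<close> and \<open>t\<^sup>2 * B v\<close> approximate the same number up
  to \<open>o(t^2)\<close>.\<close>

lemma symmetric_second_derivative:
  fixes f :: "'a::real_normed_vector \<Rightarrow> real"
  assumes "open U" "a \<in> U"
    and g: "\<And>y. y \<in> U \<Longrightarrow> (f has_derivative g y) (at y)"
    and A: "((\<lambda>y. g y v) has_derivative A) (at a)"
    and B: "((\<lambda>y. g y w) has_derivative B) (at a)"
  shows "A w = B v"
proof (rule ccontr)
  assume "A w \<noteq> B v"
  \<comment> \<open>With a third of the gap, the two errors add up to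
    \<open>2 * e * t\<^sup>2\<close>, less than the supposed gap
    \<open>3 * e * t\<^sup>2\<close>.\<close>
  define e where "e = \<bar>A w - B v\<bar> / 3"
  have e: "e > 0" using \<open>A w \<noteq> B v\<close> by (simp add: e_def)
  obtain d1 where d1: "d1 > 0" "\<And>t. 0 < t \<Longrightarrow> t < d1 \<Longrightarrow>
    \<bar>f (a + t *\<^sub>R v + t *\<^sub>R w) - f (a + t *\<^sub>R v) - f (a + t *\<^sub>R w) + f a - t\<^sup>2 * A w\<bar> \<le> e * t\<^sup>2"
    using second_difference_bound[OF assms(1,2) g A e, of w] by blast
  obtain d2 where d2: "d2 > 0" "\<And>t. 0 < t \<Longrightarrow> t < d2 \<Longrightarrow>
    \<bar>f (a + t *\<^sub>R w + t *\<^sub>R v) - f (a + t *\<^sub>R w) - f (a + t *\<^sub>R v) + f a - t\<^sup>2 * B v\<bar> \<le> e * t\<^sup>2"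
    using second_difference_bound[OF assms(1,2) g B e, of v] by blast
  define t where "t = min d1 d2 / 2"
  have t: "0 < t" "t < d1" "t < d2" using d1(1) d2(1) by (auto simp: t_def)
  have "a + t *\<^sub>R w + t *\<^sub>R v = a + t *\<^sub>R v + t *\<^sub>R w" by (simp add: algebra_simps)
  then have "\<bar>t\<^sup>2 * A w - t\<^sup>2 * B v\<bar> \<le> 2 * (e * t\<^sup>2)"
    using d1(2)[OF t(1,2)] d2(2)[OF t(1,3)] by (smt (verit))
  also have "\<bar>t\<^sup>2 * A w - t\<^sup>2 * B v\<bar> = t\<^sup>2 * (3 * e)"
    by (simp add: e_def abs_mult flip: right_diff_distrib)
  finally show False using e t by (simp add: zero_less_mult_iff)
qed

text \<open>Linearity is demanded in the first slot only; invariance under rearrangement, phrased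
  with multisets, carries it to every other slot.\<close>

definition sym_multilinear :: "nat \<Rightarrow> ('a::real_vector list \<Rightarrow> real) \<Rightarrow> bool" where
  "sym_multilinear n A \<longleftrightarrow>
     (\<forall>us. Suc (length us) = n \<longrightarrow> linear (\<lambda>v. A (v # us))) \<and>
     (\<forall>us vs. length us = n \<longrightarrow> mset us = mset vs \<longrightarrow> A us = A vs)"

lemma sym_multilinear_perm:
  "sym_multilinear n A \<Longrightarrow> length us = n \<Longrightarrow> mset us = mset vs \<Longrightarrow> A us = A vs"
  unfolding sym_multilinear_def by blast

lemma sym_multilinear_linear:
  "sym_multilinear n A \<Longrightarrow> Suc (length us) = n \<Longrightarrow> linear (\<lambda>v. A (v # us))"
  unfolding sym_multilinear_def by blast

lemma deriv_tower_has_derivative: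
  assumes "deriv_tower f p D U" "k < p" "y \<in> U" "length us = k"
  shows "((\<lambda>z. D k z us) has_derivative (\<lambda>v. D (Suc k) y (v # us))) (at y)"
  using assms unfolding deriv_tower_def by blast

text \<open>Permutations of the tail are inherited by differentiating the symmetric form
  \<open>D k\<close>, and the first two slots can be exchanged by symmetry of second derivatives.
  These two kinds of moves generate all permutations.\<close>

lemma deriv_tower_sym_multilinear:
  assumes D: "deriv_tower f p D U" and U: "open U"
  shows "k \<le> p \<Longrightarrow> y \<in> U \<Longrightarrow> sym_multilinear k (D k y)"
proof (induction k arbitrary: y)
  case 0
  then show ?case by (simp add: sym_multilinear_def)
next
  case (Suc k)
  have lin: "linear (\<lambda>v. D (Suc k) y (v # us))" if "length us = k" for us
    using deriv_tower_has_derivative[OF D, of k y us] Suc.prems that has_derivative_linear by fastforce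
  have tl: "D (Suc k) y (v # us) = D (Suc k) y (v # vs)" if "length us = k" "mset us = mset vs" for v us vs
  proof -
    have eq: "D k z us = D k z vs" if "z \<in> U" for z
      using sym_multilinear_perm[OF Suc.IH[OF _ \<open>z \<in> U\<close>] \<open>length us = k\<close> \<open>mset us = mset vs\<close>] Suc.prems
      by simp
    have "length vs = k" using that by (metis size_mset)
    have d1: "((\<lambda>z. D k z vs) has_derivative (\<lambda>v. D (Suc k) y (v # us))) (at y)"
      using has_derivative_transform_within_open[OF deriv_tower_has_derivative[OF D, of k y us] U, of "\<lambda>z. D k z vs"]
        eq that Suc.prems by auto
    have d2: "((\<lambda>z. D k z vs) has_derivative (\<lambda>v. D (Suc k) y (v # vs))) (at y)"
      using deriv_tower_has_derivative[OF D, of k y vs] \<open>length vs = k\<close> Suc.prems by simp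
    have "(\<lambda>v. D (Suc k) y (v # us)) = (\<lambda>v. D (Suc k) y (v # vs))"
      by (rule has_derivative_unique[OF d1 d2])
    then show ?thesis by meson
  qed
  have swap: "D (Suc k) y (v # w # us) = D (Suc k) y (w # v # us)" if k: "k = Suc (length us)" for v w us
  proof (rule symmetric_second_derivative[OF U \<open>y \<in> U\<close>, where f = "\<lambda>z. D (length us) z us"
        and g = "\<lambda>z v. D k z (v # us)" and A = "\<lambda>v. D (Suc k) y (v # w # us)"
        and B = "\<lambda>w. D (Suc k) y (w # v # us)"])
    show "((\<lambda>z. D (length us) z us) has_derivative (\<lambda>v. D k z (v # us))) (at z)" if "z \<in> U" for z
      using deriv_tower_has_derivative[OF D _ that, of "length us" us] k Suc.prems by simp
    show "((\<lambda>z. D k z (w # us)) has_derivative (\<lambda>v. D (Suc k) y (v # w # us))) (at y)"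
      using deriv_tower_has_derivative[OF D, of k y "w # us"] k Suc.prems by simp
    show "((\<lambda>z. D k z (v # us)) has_derivative (\<lambda>w. D (Suc k) y (w # v # us))) (at y)"
      using deriv_tower_has_derivative[OF D, of k y "v # us"] k Suc.prems by simp
  qed
  have perm: "D (Suc k) y us = D (Suc k) y vs" if len: "length us = Suc k" and eq: "mset us = mset vs" for us vs
  proof -
    from len obtain v us' where us: "us = v # us'" "length us' = k" by (cases us) auto
    from len eq have "length vs = Suc k" by (metis size_mset)
    then obtain w vs' where vs: "vs = w # vs'" "length vs' = k" by (cases vs) auto
    show ?thesis
    proof (cases "v = w")
      case True
      then show ?thesis using tl[of us' vs' v] us vs eq by simp
    next
      case False
      \<comment> \<open>With different heads, each list contains the head of the other. Rearranging
        tails brings them to \<open>v # w # ws\<close> and \<open>w # v # ws\<close> with a common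
        rest, which one exchange identifies.\<close>
      have e: "add_mset v (mset us') = add_mset w (mset vs')" using eq us vs by simp
      then obtain M where M: "mset us' = add_mset w M" "mset vs' = add_mset v M"
        using False by (auto simp: add_eq_conv_ex)
      obtain ws where ws: "mset ws = M" using ex_mset by blast
      have k: "k = Suc (length ws)" using M ws us(2) by (metis size_mset size_add_mset)
      have "D (Suc k) y us = D (Suc k) y (v # w # ws)"
        unfolding us using us M ws by (intro tl) auto
      also have "\<dots> = D (Suc k) y (w # v # ws)" by (rule swap[OF k])
      also have "\<dots> = D (Suc k) y vs"
        unfolding vs using vs M ws k by (intro tl) auto
      finally show ?thesis .
    qed
  qed
  show ?case unfolding sym_multilinear_def using lin perm by blast
qed

subsection \<open>Symmetric multilinear forms\<close>

lemma sym_multilinear_insert_linear: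
  assumes A: "sym_multilinear N A" and "Suc (length xs + length ys) = N"
  shows "linear (\<lambda>v. A (xs @ v # ys))"
proof -
  have "A (xs @ v # ys) = A (v # xs @ ys)" for v
    using assms by (intro sym_multilinear_perm[OF A]) auto
  then show ?thesis using sym_multilinear_linear[OF A, of "xs @ ys"] assms by simp
qed

lemma sym_multilinear_replicate_scale:
  assumes A: "sym_multilinear N A"
  shows "length xs + n + length ys = N \<Longrightarrow>
    A (xs @ replicate n (c *\<^sub>R u) @ ys) = c ^ n * A (xs @ replicate n u @ ys)"
proof (induction n arbitrary: xs)
  case (Suc n)
  have "A (xs @ replicate (Suc n) (c *\<^sub>R u) @ ys) = c * A (xs @ u # replicate n (c *\<^sub>R u) @ ys)"
    using linear_cmul[OF sym_multilinear_insert_linear[OF A, of xs "replicate n (c *\<^sub>R u) @ ys"]] Suc.prems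
    by simp
  then show ?case using Suc.IH[of "xs @ [u]"] Suc.prems by simp
qed simp

text \<open>The passive arguments \<open>ys\<close> are kept general so that the induction can move
  the vector split off from the front into them; Pascal's rule then merges the two sums.\<close>

lemma sym_multilinear_binomial_aux:
  assumes A: "sym_multilinear N A"
  shows "n + length ys = N \<Longrightarrow>
    A (replicate n (u + v) @ ys) = (\<Sum>j\<le>n. real (n choose j) * A (replicate (n - j) u @ replicate j v @ ys))"
proof (induction n arbitrary: ys)
  case (Suc n)
  let ?S = "\<lambda>m j. A (replicate m u @ replicate j v @ ys)"
  have "A (replicate (Suc n) (u + v) @ ys)
      = A (u # replicate n (u + v) @ ys) + A (v # replicate n (u + v) @ ys)"
    using linear_add[OF sym_multilinear_linear[OF A, of "replicate n (u + v) @ ys"]] Suc.prems by simp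
  also have "A (u # replicate n (u + v) @ ys) = A (replicate n (u + v) @ u # ys)"
    using Suc.prems by (intro sym_multilinear_perm[OF A]) auto
  also have "A (v # replicate n (u + v) @ ys) = A (replicate n (u + v) @ v # ys)"
    using Suc.prems by (intro sym_multilinear_perm[OF A]) auto
  also have "A (replicate n (u + v) @ u # ys) = (\<Sum>j\<le>n. real (n choose j) * ?S (Suc n - j) j)"
  proof (subst Suc.IH)
    show "(\<Sum>j\<le>n. real (n choose j) * A (replicate (n - j) u @ replicate j v @ u # ys))
       = (\<Sum>j\<le>n. real (n choose j) * ?S (Suc n - j) j)"
    proof (rule sum.cong[OF refl])
      fix j assume "j \<in> {..n}"
      then have "A (replicate (n - j) u @ replicate j v @ u # ys) = ?S (Suc n - j) j"
        using Suc.prems by (intro sym_multilinear_perm[OF A]) (auto simp: Suc_diff_le)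
      then show "real (n choose j) * A (replicate (n - j) u @ replicate j v @ u # ys)
          = real (n choose j) * ?S (Suc n - j) j" by simp
    qed
  qed (use Suc.prems in simp)
  also have "A (replicate n (u + v) @ v # ys) = (\<Sum>j\<le>n. real (n choose j) * ?S (n - j) (Suc j))"
  proof (subst Suc.IH)
    show "(\<Sum>j\<le>n. real (n choose j) * A (replicate (n - j) u @ replicate j v @ v # ys))
       = (\<Sum>j\<le>n. real (n choose j) * ?S (n - j) (Suc j))"
    proof (rule sum.cong[OF refl])
      fix j assume "j \<in> {..n}"
      then have "A (replicate (n - j) u @ replicate j v @ v # ys) = ?S (n - j) (Suc j)"
        using Suc.prems by (intro sym_multilinear_perm[OF A]) auto
      then show "real (n choose j) * A (replicate (n - j) u @ replicate j v @ v # ys)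
          = real (n choose j) * ?S (n - j) (Suc j)" by simp
    qed
  qed (use Suc.prems in simp)
  also have "(\<Sum>j\<le>n. real (n choose j) * ?S (Suc n - j) j)
      = ?S (Suc n) 0 + (\<Sum>j\<le>n. real (n choose Suc j) * ?S (n - j) (Suc j))"
  proof -
    have "(\<Sum>j\<le>n. real (n choose j) * ?S (Suc n - j) j) = (\<Sum>j\<le>Suc n. real (n choose j) * ?S (Suc n - j) j)"
      by simp
    also have "\<dots> = ?S (Suc n) 0 + (\<Sum>j\<le>n. real (n choose Suc j) * ?S (n - j) (Suc j))"
      by (subst sum.atMost_Suc_shift) simp
    finally show ?thesis .
  qed
  also have "?S (Suc n) 0 + (\<Sum>j\<le>n. real (n choose Suc j) * ?S (n - j) (Suc j))
       + (\<Sum>j\<le>n. real (n choose j) * ?S (n - j) (Suc j))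
     = (\<Sum>j\<le>Suc n. real (Suc n choose j) * ?S (Suc n - j) j)"
    by (subst sum.atMost_Suc_shift) (simp add: sum.distrib[symmetric] algebra_simps)
  finally show ?case .
qed simp

lemma sym_multilinear_binomial:
  assumes A: "sym_multilinear n A"
  shows "A (replicate n (a *\<^sub>R u + b *\<^sub>R v))
    = (\<Sum>j\<le>n. (real (n choose j) * a ^ (n - j) * b ^ j) * A (replicate (n - j) u @ replicate j v))"
proof -
  have "A (replicate (n - j) (a *\<^sub>R u) @ replicate j (b *\<^sub>R v))
      = a ^ (n - j) * (b ^ j * A (replicate (n - j) u @ replicate j v))" if "j \<le> n" for j
    using sym_multilinear_replicate_scale[OF A, of "[]" "n - j" "replicate j (b *\<^sub>R v)" a u]
      sym_multilinear_replicate_scale[OF A, of "replicate (n - j) u" j "[]" b v] that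
    by simp
  then show ?thesis
    using sym_multilinear_binomial_aux[OF A, of n "[]" "a *\<^sub>R u" "b *\<^sub>R v"]
    by (simp add: mult_ac)
qed

lemma sym_multilinear_replicate_derivative:
  assumes A: "sym_multilinear n A"
  shows "((\<lambda>t. A (replicate n (u + t *\<^sub>R v))) has_real_derivative
      (if n = 0 then 0 else n * A (v # replicate (n - 1) u))) (at 0)"
proof -
  let ?c = "\<lambda>j. real (n choose j) * A (replicate (n - j) u @ replicate j v)"
  have eq: "(\<lambda>t. A (replicate n (u + t *\<^sub>R v))) = (\<lambda>t. \<Sum>j\<le>n. ?c j * t ^ j)"
    using sym_multilinear_binomial[OF A, of 1 u _ v] by (simp add: mult_ac fun_eq_iff)
  have "((\<lambda>t. \<Sum>j\<le>n. ?c j * t ^ j) has_real_derivative (\<Sum>j\<le>n. ?c j * (real j * 0 ^ (j - Suc 0)))) (at 0)"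
    by (auto intro!: derivative_eq_intros sum.cong)
  moreover have "(\<Sum>j\<le>n. ?c j * (real j * 0 ^ (j - Suc 0))) = (if n = 0 then 0 else n * A (v # replicate (n - 1) u))"
  proof (cases "n = 0")
    case False
    \<comment> \<open>By truncated subtraction the power of 0 equals 1 for both \<open>j = 0\<close>
      and \<open>j = 1\<close>; the factor \<open>real j\<close> removes the former, so only the
      linear coefficient survives.\<close>
    have "(\<Sum>j\<le>n. ?c j * (real j * 0 ^ (j - Suc 0))) = (\<Sum>j\<le>n. if j = 1 then ?c 1 else 0)"
      by (intro sum.cong) (auto simp: power_0_left)
    also have "\<dots> = ?c 1" using False by (simp add: sum.delta)
    also have "A (replicate (n - 1) u @ replicate 1 v) = A (v # replicate (n - 1) u)"
      using False by (intro sym_multilinear_perm[OF A]) auto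
    finally show ?thesis using False by simp
  qed simp
  ultimately show ?thesis unfolding eq by simp
qed

subsection \<open>Quadrature with Fejer weights\<close>

lemma cis_2pi_fraction_eq_1_iff:
  assumes "n > 0"
  shows "cis (2 * pi * (of_int i / real n)) = 1 \<longleftrightarrow> int n dvd i"
proof
  assume "cis (2 * pi * (of_int i / real n)) = 1"
  then have "cos (2 * pi * (of_int i / real n)) = 1" by (simp add: complex_eq_iff)
  then obtain m :: int where "2 * pi * (of_int i / real n) = of_int m * 2 * pi"
    by (auto simp: cos_one_2pi_int)
  then have "2 * pi * (of_int i / real n - of_int m) = 0" by (simp add: algebra_simps)
  then have "of_int i / real n = of_int m" by simp
  then have "real_of_int i = of_int (m * int n)"
    using assms by (simp add: field_simps)
  then show "int n dvd i" by (metis dvd_triv_right of_int_eq_iff)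
next
  assume "int n dvd i"
  then obtain m where "i = int n * m" by blast
  then show "cis (2 * pi * (of_int i / real n)) = 1"
    using assms by (simp add: cis_multiple_2pi)
qed

text \<open>The summand is a fixed phase times the \<open>k\<close>-th power of an
  \<open>n\<close>-th root of unity, so the geometric sum vanishes unless that root is 1.\<close>

lemma sum_cis_shifted_roots:
  fixes i :: int and \<phi> :: real
  assumes "n > 0"
  shows "(\<Sum>k<n. cis (2 * of_int i * ((\<phi> + real k * pi) / real n)))
    = (if int n dvd i then of_nat n * cis (2 * of_int i * \<phi> / real n) else 0)"
proof -
  define w where "w = cis (2 * pi * (of_int i / real n))"
  have "cis (2 * of_int i * ((\<phi> + real k * pi) / real n)) = cis (2 * of_int i * \<phi> / real n) * w ^ k" for k
    unfolding w_def Complex.DeMoivre cis_mult by (simp add: add_divide_distrib algebra_simps)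
  then have eq: "(\<Sum>k<n. cis (2 * of_int i * ((\<phi> + real k * pi) / real n)))
      = cis (2 * of_int i * \<phi> / real n) * (\<Sum>k<n. w ^ k)"
    by (simp add: sum_distrib_left)
  show ?thesis
  proof (cases "int n dvd i")
    case True
    then have "w = 1" using cis_2pi_fraction_eq_1_iff[OF assms] by (simp add: w_def)
    then show ?thesis using True eq by simp
  next
    case False
    then have "w \<noteq> 1" using cis_2pi_fraction_eq_1_iff[OF assms] by (simp add: w_def)
    moreover have "w ^ n = 1"
      unfolding w_def Complex.DeMoivre using assms cis_multiple_2pi[of "of_int i"] by simp
    ultimately show ?thesis using False eq by (simp add: geometric_sum)
  qed
qed

text \<open>Values at the nodes \<open>\<theta> k = (\<phi> + k \<pi>) / n\<close> of the Fejer kernel, normalised to total mass 1.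
  The node shift \<open>\<phi> / n\<close> makes \<open>cis (n \<theta> k) = (-1)^k cis \<phi>\<close>.\<close>

definition fejer_weight :: "nat \<Rightarrow> real \<Rightarrow> nat \<Rightarrow> real" where
  "fejer_weight n \<phi> k = (cmod (\<Sum>m<n. cis (2 * real m * ((\<phi> + real k * pi) / real n))))\<^sup>2 / (real n)\<^sup>2"

lemma fejer_weight_nonneg: "fejer_weight n \<phi> k \<ge> 0"
  by (simp add: fejer_weight_def)

text \<open>Expanding the squared modulus gives a double sum over \<open>m\<close> and
  \<open>m'\<close>, and summing over the nodes keeps only pairs with \<open>m - m' - l\<close>
  divisible by \<open>n\<close>. Each \<open>m'\<close> has exactly one partner: for
  \<open>n - l\<close> of them the difference is 0, for the other \<open>l\<close> it wraps around
  to \<open>-n\<close> and contributes the phase \<open>cis (- 2 * \<phi>)\<close>.\<close>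

lemma fejer_weight_moments:
  assumes n: "n > 0" and l: "l \<le> n"
  shows "(\<Sum>k<n. of_real (fejer_weight n \<phi> k) * cis (- 2 * real l * ((\<phi> + real k * pi) / real n)))
    = (of_nat (n - l) + of_nat l * cis (- 2 * \<phi>)) / of_nat n"
proof -
  let ?\<theta> = "\<lambda>k. (\<phi> + real k * pi) / real n"
  have w: "complex_of_real (fejer_weight n \<phi> k) * cis (- 2 * real l * ?\<theta> k)
      = (\<Sum>m'<n. \<Sum>m<n. cis (2 * of_int (int m - int m' - int l) * ?\<theta> k)) / (of_nat n)\<^sup>2" for k
  proof -
    let ?S = "\<Sum>m<n. cis (2 * real m * ?\<theta> k)"
    have prod3: "cis (2 * real m * ?\<theta> k) * cis (- (2 * real m' * ?\<theta> k)) * cis (- 2 * real l * ?\<theta> k)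
      = cis (2 * of_int (int m - int m' - int l) * ?\<theta> k)" for m m'
    proof -
      have "2 * a * x + - (2 * b * x) + - 2 * c * x = 2 * (a - b - c) * x" for a b c x :: real
        by (simp add: algebra_simps)
      then show ?thesis unfolding cis_mult of_int_diff of_int_of_nat_eq by (rule arg_cong)
    qed
    have "complex_of_real (fejer_weight n \<phi> k) = ?S * cnj ?S / (of_nat n)\<^sup>2"
      unfolding fejer_weight_def of_real_divide complex_norm_square[symmetric] by simp
    also have "?S * cnj ?S = (\<Sum>m'<n. \<Sum>m<n. cis (2 * real m * ?\<theta> k) * cis (- (2 * real m' * ?\<theta> k)))"
      unfolding cnj_sum cis_cnj sum_product by (rule sum.swap)
    finally have "complex_of_real (fejer_weight n \<phi> k) * cis (- 2 * real l * ?\<theta> k)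
      = (\<Sum>m'<n. \<Sum>m<n. cis (2 * real m * ?\<theta> k) * cis (- (2 * real m' * ?\<theta> k)) * cis (- 2 * real l * ?\<theta> k)) / (of_nat n)\<^sup>2"
      by (simp add: sum_distrib_right sum_divide_distrib)
    also have "\<dots> = (\<Sum>m'<n. \<Sum>m<n. cis (2 * of_int (int m - int m' - int l) * ?\<theta> k)) / (of_nat n)\<^sup>2"
      unfolding prod3 ..
    finally show ?thesis .
  qed
  have "(\<Sum>k<n. of_real (fejer_weight n \<phi> k) * cis (- 2 * real l * ?\<theta> k))
      = (\<Sum>m'<n. \<Sum>m<n. \<Sum>k<n. cis (2 * of_int (int m - int m' - int l) * ?\<theta> k)) / (of_nat n)\<^sup>2"
    unfolding w sum_divide_distrib[symmetric]
    by (subst sum.swap) (intro arg_cong[where f = "\<lambda>z. z / _"] sum.cong refl sum.swap)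
  also have "(\<Sum>m'<n. \<Sum>m<n. \<Sum>k<n. cis (2 * of_int (int m - int m' - int l) * ?\<theta> k))
      = (\<Sum>m'<n. of_nat n * (if m' < n - l then 1 else cis (- 2 * \<phi>)))"
  proof (rule sum.cong[OF refl])
    fix m' assume m': "m' \<in> {..<n}"
    \<comment> \<open>This is the residue of \<open>m' + l\<close> modulo \<open>n\<close>; since
      \<open>m' + l < 2 * n\<close>, one subtraction of \<open>n\<close> suffices.\<close>
    define m0 where "m0 = (if m' < n - l then m' + l else m' + l - n)"
    have m0: "m0 < n" and i0: "int m0 - int m' - int l = (if m' < n - l then 0 else - int n)"
      using m' l n by (auto simp: m0_def)
    have dvd: "int n dvd int m - int m' - int l \<longleftrightarrow> m = m0" if "m < n" for m
    proof
      assume d: "int n dvd int m - int m' - int l"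
      have "int n dvd int m0 - int m' - int l" using i0 by auto
      with d have "int n dvd (int m - int m' - int l) - (int m0 - int m' - int l)" by (rule dvd_diff)
      then have "int n dvd int m - int m0" by simp
      moreover have "\<bar>int m - int m0\<bar> < int n" using that m0 by linarith
      ultimately have "int m - int m0 = 0"
        using dvd_imp_le_int[of "int m - int m0" "int n"] by (metis abs_of_nat linorder_not_less)
      then show "m = m0" by simp
    qed (use i0 in auto)
    have "(\<Sum>m<n. \<Sum>k<n. cis (2 * of_int (int m - int m' - int l) * ?\<theta> k))
        = (\<Sum>m<n. if m = m0 then of_nat n * cis (2 * of_int (int m0 - int m' - int l) * \<phi> / real n) else 0)"
      using dvd by (intro sum.cong refl) (auto simp only: sum_cis_shifted_roots[OF n] lessThan_iff split: if_splits)
    also have "\<dots> = of_nat n * cis (2 * of_int (int m0 - int m' - int l) * \<phi> / real n)"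
      using m0 by (simp add: sum.delta)
    also have "\<dots> = of_nat n * (if m' < n - l then 1 else cis (- 2 * \<phi>))"
      unfolding i0 using n by simp
    finally show "(\<Sum>m<n. \<Sum>k<n. cis (2 * of_int (int m - int m' - int l) * ?\<theta> k))
      = of_nat n * (if m' < n - l then 1 else cis (- 2 * \<phi>))" .
  qed
  also have "\<dots> = of_nat n * (\<Sum>m'<n. (if m' < n - l then 1 else cis (- 2 * \<phi>)))"
    by (simp add: sum_distrib_left)
  also have "(\<Sum>m'<n. (if m' < n - l then 1 else cis (- 2 * \<phi>))) = of_nat (n - l) + of_nat l * cis (- 2 * \<phi>)"
  proof -
    have "{..<n} \<inter> {m'. m' < n - l} = {..<n - l}" "{..<n} \<inter> - {m'. m' < n - l} = {n - l..<n}" by auto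
    then show ?thesis using l by (simp add: sum.If_cases)
  qed
  finally show ?thesis using n by (simp add: power2_eq_square)
qed

lemma sum_fejer_weight:
  assumes "n > 0"
  shows "(\<Sum>k<n. fejer_weight n \<phi> k) = 1"
proof -
  have "complex_of_real (\<Sum>k<n. fejer_weight n \<phi> k) = 1"
    using fejer_weight_moments[OF assms, of 0 \<phi>] assms by simp
  then show ?thesis by (metis of_real_eq_1_iff)
qed

text \<open>By absorption, \<open>l\<close> times \<open>n choose l\<close> is \<open>n\<close>
  times \<open>(n - 1) choose (l - 1)\<close>. The formula evaluates the part of the affine moments
  that is proportional to the index.\<close>

lemma sum_binomial_weighted:
  fixes a b :: complex
  assumes "n > 0"
  shows "(\<Sum>l\<le>n. of_nat (n choose l) * b ^ l * a ^ (n - l) * of_nat l) = of_nat n * b * (b + a) ^ (n - 1)"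
proof -
  obtain m where m: "n = Suc m" using assms by (cases n) auto
  have "(\<Sum>l\<le>n. of_nat (n choose l) * b ^ l * a ^ (n - l) * of_nat l)
      = (\<Sum>l\<le>m. of_nat (Suc l * (Suc m choose Suc l)) * b ^ Suc l * a ^ (m - l))"
    unfolding m by (subst sum.atMost_Suc_shift) (simp add: mult_ac del: binomial_Suc_Suc of_nat_Suc mult_Suc)
  also have "\<dots> = (\<Sum>l\<le>m. of_nat n * b * (of_nat (m choose l) * b ^ l * a ^ (m - l)))"
    unfolding Suc_times_binomial by (simp add: m mult_ac del: binomial_Suc_Suc of_nat_Suc mult_Suc)
  also have "\<dots> = of_nat n * b * (b + a) ^ m"
    by (simp add: sum_distrib_left binomial_ring)
  finally show ?thesis by (simp add: m)
qed

text \<open>Writing \<open>cos s + t sin s = \<alpha> cis s + \<beta> cis (-s)\<close> with \<open>\<alpha> + \<beta> = 1\<close>, the binomial theorem turns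
  the left-hand side into the moments of the weights, which are affine in the index.\<close>

lemma fejer_quadrature:
  fixes t \<phi> :: real
  assumes n: "n > 0"
  defines "\<theta> \<equiv> \<lambda>k. (\<phi> + real k * pi) / real n"
  shows "(\<Sum>k<n. (-1) ^ k * fejer_weight n \<phi> k * (cos (\<theta> k) + t * sin (\<theta> k)) ^ n) = cos \<phi> + t * sin \<phi>"
proof -
  define \<alpha> \<beta> :: complex where "\<alpha> = (1 - \<i> * t) / 2" and "\<beta> = (1 + \<i> * t) / 2"
  have ab: "\<beta> + \<alpha> = 1" by (simp add: \<alpha>_def \<beta>_def field_simps)
  have lin: "complex_of_real (cos s + t * sin s) = \<alpha> * cis s + \<beta> * cis (- s)" for s
    by (simp add: \<alpha>_def \<beta>_def complex_eq_iff field_simps)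
  have node: "complex_of_real ((-1) ^ k * fejer_weight n \<phi> k * (cos (\<theta> k) + t * sin (\<theta> k)) ^ n)
     = cis \<phi> * (\<Sum>l\<le>n. of_nat (n choose l) * \<beta> ^ l * \<alpha> ^ (n - l) *
         (of_real (fejer_weight n \<phi> k) * cis (- 2 * real l * \<theta> k)))" for k
  proof -
    have "\<alpha> * cis (\<theta> k) + \<beta> * cis (- \<theta> k) = cis (\<theta> k) * (\<beta> * cis (- 2 * \<theta> k) + \<alpha>)"
      by (simp add: algebra_simps cis_mult)
    then have "complex_of_real (cos (\<theta> k) + t * sin (\<theta> k)) ^ n
       = cis (\<theta> k) ^ n * (\<beta> * cis (- 2 * \<theta> k) + \<alpha>) ^ n"
      unfolding lin by (simp add: power_mult_distrib)
    \<comment> \<open>The sign produced here cancels the alternating sign of the quadrature, which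
      leaves the nonnegative weights alone.\<close>
    also have "cis (\<theta> k) ^ n = cis \<phi> * (-1) ^ k"
    proof -
      have "cis (\<theta> k) ^ n = cis (\<phi> + real k * pi)"
        using n by (simp add: Complex.DeMoivre \<theta>_def)
      also have "\<dots> = cis \<phi> * cis pi ^ k" unfolding Complex.DeMoivre cis_mult by simp
      finally show ?thesis by simp
    qed
    also have "(\<beta> * cis (- 2 * \<theta> k) + \<alpha>) ^ n
       = (\<Sum>l\<le>n. of_nat (n choose l) * \<beta> ^ l * \<alpha> ^ (n - l) * cis (- 2 * real l * \<theta> k))"
      unfolding binomial_ring power_mult_distrib Complex.DeMoivre by (simp add: mult_ac)
    finally have "complex_of_real ((-1) ^ k * fejer_weight n \<phi> k * (cos (\<theta> k) + t * sin (\<theta> k)) ^ n)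
      = ((-1) ^ k * (-1) ^ k) * cis \<phi> * (of_real (fejer_weight n \<phi> k) *
         (\<Sum>l\<le>n. of_nat (n choose l) * \<beta> ^ l * \<alpha> ^ (n - l) * cis (- 2 * real l * \<theta> k)))"
      unfolding of_real_mult of_real_power by (simp only: mult_ac) simp
    then show ?thesis
      by (simp add: power_mult_distrib[symmetric] sum_distrib_left mult_ac)
  qed
  have "complex_of_real (\<Sum>k<n. (-1) ^ k * fejer_weight n \<phi> k * (cos (\<theta> k) + t * sin (\<theta> k)) ^ n)
     = cis \<phi> * (\<Sum>k<n. \<Sum>l\<le>n. of_nat (n choose l) * \<beta> ^ l * \<alpha> ^ (n - l) *
         (of_real (fejer_weight n \<phi> k) * cis (- 2 * real l * \<theta> k)))"
    unfolding of_real_sum node by (simp add: sum_distrib_left)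
  also have "\<dots> = cis \<phi> * (\<Sum>l\<le>n. of_nat (n choose l) * \<beta> ^ l * \<alpha> ^ (n - l) *
         (\<Sum>k<n. of_real (fejer_weight n \<phi> k) * cis (- 2 * real l * \<theta> k)))"
    by (subst sum.swap) (simp add: sum_distrib_left)
  also have "\<dots> = cis \<phi> * (\<Sum>l\<le>n. of_nat (n choose l) * \<beta> ^ l * \<alpha> ^ (n - l) *
        (1 + of_nat l * ((cis (- 2 * \<phi>) - 1) / of_nat n)))"
  proof (intro arg_cong[where f = "\<lambda>z. cis \<phi> * z"] sum.cong refl)
    fix l assume "l \<in> {..n}"
    then have "(\<Sum>k<n. of_real (fejer_weight n \<phi> k) * cis (- 2 * real l * \<theta> k))
       = (of_nat (n - l) + of_nat l * cis (- 2 * \<phi>)) / of_nat n"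
      unfolding \<theta>_def using fejer_weight_moments[OF n] by simp
    also have "\<dots> = 1 + of_nat l * ((cis (- 2 * \<phi>) - 1) / of_nat n)"
      using n \<open>l \<in> {..n}\<close> by (simp add: field_simps of_nat_diff)
    finally show "of_nat (n choose l) * \<beta> ^ l * \<alpha> ^ (n - l) *
         (\<Sum>k<n. of_real (fejer_weight n \<phi> k) * cis (- 2 * real l * \<theta> k))
       = of_nat (n choose l) * \<beta> ^ l * \<alpha> ^ (n - l) * (1 + of_nat l * ((cis (- 2 * \<phi>) - 1) / of_nat n))"
      by (rule arg_cong)
  qed
  also have "\<dots> = cis \<phi> * ((\<Sum>l\<le>n. of_nat (n choose l) * \<beta> ^ l * \<alpha> ^ (n - l)) +
       (\<Sum>l\<le>n. of_nat (n choose l) * \<beta> ^ l * \<alpha> ^ (n - l) * of_nat l) * ((cis (- 2 * \<phi>) - 1) / of_nat n))"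
    by (simp only: distrib_left sum.distrib sum_distrib_right mult_1_right mult.assoc)
  \<comment> \<open>Because \<open>\<beta> + \<alpha> = 1\<close>, the plain binomial sum is 1 and
    the weighted one is \<open>n * \<beta>\<close>.\<close>
  also have "\<dots> = cis \<phi> * (1 + \<beta> * (cis (- 2 * \<phi>) - 1))"
    unfolding sum_binomial_weighted[OF n] binomial_ring[symmetric] ab using n by simp
  also have "\<dots> = cis \<phi> * (\<alpha> + \<beta> * cis (- 2 * \<phi>))"
  proof -
    have a: "\<alpha> = 1 - \<beta>" using ab by (simp add: algebra_simps)
    show ?thesis unfolding a by (simp add: algebra_simps)
  qed
  also have "\<dots> = \<alpha> * cis \<phi> + \<beta> * cis (- \<phi>)"
    by (simp add: algebra_simps cis_mult)
  also have "\<dots> = complex_of_real (cos \<phi> + t * sin \<phi>)" by (rule lin[symmetric])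
  finally show ?thesis by (metis of_real_eq_iff)
qed

text \<open>Both sides of \<open>fejer_quadrature\<close> are polynomials in \<open>t\<close> that
  agree for every real \<open>t\<close>, so their coefficients agree.\<close>

lemma fejer_quadrature_coeffs:
  fixes \<phi> :: real
  assumes n: "n > 0" and j: "j \<le> n"
  defines "\<theta> \<equiv> \<lambda>k. (\<phi> + real k * pi) / real n"
  shows "(\<Sum>k<n. (-1) ^ k * fejer_weight n \<phi> k * (real (n choose j) * cos (\<theta> k) ^ (n - j) * sin (\<theta> k) ^ j))
    = (if j = 0 then cos \<phi> else if j = 1 then sin \<phi> else 0)" (is "?c j = ?d j")
proof -
  have "(\<Sum>i\<le>n. ?c i * t ^ i) = (\<Sum>i\<le>n. ?d i * t ^ i)" for t :: real
  proof -
    have "(\<Sum>i\<le>n. ?c i * t ^ i) = (\<Sum>k<n. \<Sum>i\<le>n. (-1) ^ k * fejer_weight n \<phi> k *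
        (real (n choose i) * cos (\<theta> k) ^ (n - i) * sin (\<theta> k) ^ i) * t ^ i)"
      unfolding sum_distrib_right by (rule sum.swap)
    also have "\<dots> = (\<Sum>k<n. (-1) ^ k * fejer_weight n \<phi> k * (cos (\<theta> k) + t * sin (\<theta> k)) ^ n)"
    proof (rule sum.cong[OF refl])
      fix k
      have "(cos (\<theta> k) + t * sin (\<theta> k)) ^ n = (t * sin (\<theta> k) + cos (\<theta> k)) ^ n" by (simp add: add.commute)
      also have "\<dots> = (\<Sum>i\<le>n. (real (n choose i) * cos (\<theta> k) ^ (n - i) * sin (\<theta> k) ^ i) * t ^ i)"
        unfolding binomial_ring power_mult_distrib by (simp add: mult_ac)
      finally show "(\<Sum>i\<le>n. (-1) ^ k * fejer_weight n \<phi> k *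
        (real (n choose i) * cos (\<theta> k) ^ (n - i) * sin (\<theta> k) ^ i) * t ^ i)
        = (-1) ^ k * fejer_weight n \<phi> k * (cos (\<theta> k) + t * sin (\<theta> k)) ^ n"
        by (simp add: sum_distrib_left mult.assoc)
    qed
    also have "\<dots> = cos \<phi> + t * sin \<phi>" unfolding \<theta>_def by (rule fejer_quadrature[OF n])
    also have "\<dots> = (\<Sum>i\<le>n. ?d i * t ^ i)"
    proof -
      obtain m where m: "n = Suc m" using n by (cases n) auto
      have "(\<Sum>i\<le>n. ?d i * t ^ i) = cos \<phi> + (\<Sum>i\<le>m. ?d (Suc i) * t ^ Suc i)"
        unfolding m by (subst sum.atMost_Suc_shift) simp
      also have "(\<Sum>i\<le>m. ?d (Suc i) * t ^ Suc i) = (\<Sum>i\<le>m. if i = 0 then t * sin \<phi> else 0)"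
        by (intro sum.cong) auto
      finally show ?thesis by (simp add: sum.delta)
    qed
    finally show ?thesis .
  qed
  then have "\<forall>t::real. (\<Sum>i\<le>n. ?c i * t ^ i) = (\<Sum>i\<le>n. ?d i * t ^ i)" by blast
  then show ?thesis using j unfolding polyfun_eq_coeffs by blast
qed

subsection \<open>Mixed values of a symmetric form\<close>

lemma normB_nonneg [simp]: "pos_def_selfadjoint B \<Longrightarrow> 0 \<le> normB B x"
  unfolding normB_def pos_def_selfadjoint_def
  by (metis inner_zero_right less_eq_real_def real_sqrt_ge_0_iff)

lemma normB_power2: "pos_def_selfadjoint B \<Longrightarrow> (normB B x)\<^sup>2 = B x \<bullet> x"
  unfolding normB_def pos_def_selfadjoint_def
  by (metis inner_zero_right less_eq_real_def real_sqrt_pow2)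

lemma normB_eq_0_iff: "pos_def_selfadjoint B \<Longrightarrow> normB B x = 0 \<longleftrightarrow> x = 0"
  unfolding normB_def pos_def_selfadjoint_def
  by (metis inner_zero_right less_irrefl real_sqrt_eq_0_iff)

lemma pos_def_linear: "pos_def_selfadjoint B \<Longrightarrow> linear B"
  by (simp add: pos_def_selfadjoint_def)

lemma pos_def_commute: "pos_def_selfadjoint B \<Longrightarrow> B x \<bullet> y = B y \<bullet> x"
  by (simp add: pos_def_selfadjoint_def inner_commute)

lemma normB_combination:
  assumes B: "pos_def_selfadjoint B"
  shows "(normB B (a *\<^sub>R x + b *\<^sub>R y))\<^sup>2 = a\<^sup>2 * (normB B x)\<^sup>2 + 2 * a * b * (B x \<bullet> y) + b\<^sup>2 * (normB B y)\<^sup>2"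
  unfolding normB_power2[OF B] using pos_def_commute[OF B, of y x]
  by (simp add: linear_add[OF pos_def_linear[OF B]] linear_cmul[OF pos_def_linear[OF B]]
      inner_add_left inner_add_right power2_eq_square algebra_simps)

lemma normB_scale:
  assumes B: "pos_def_selfadjoint B"
  shows "normB B (c *\<^sub>R x) = \<bar>c\<bar> * normB B x"
proof (rule power2_eq_imp_eq)
  show "(normB B (c *\<^sub>R x))\<^sup>2 = (\<bar>c\<bar> * normB B x)\<^sup>2"
    using normB_combination[OF B, of c x 0 0] by (simp add: power_mult_distrib)
qed (use B in auto)

lemma normB_minus_commute:
  assumes B: "pos_def_selfadjoint B"
  shows "normB B (x - y) = normB B (y - x)"
  using normB_scale[OF B, of "-1" "x - y"] by simp

lemma normB_cauchy_schwarz: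
  assumes B: "pos_def_selfadjoint B"
  shows "\<bar>B x \<bullet> y\<bar> \<le> normB B x * normB B y"
proof (cases "y = 0")
  case False
  let ?b = "(normB B y)\<^sup>2" and ?c = "B x \<bullet> y"
  have b: "?b > 0" using False normB_eq_0_iff[OF B] by simp
  \<comment> \<open>Up to the factor \<open>?b\<close>, this vector is the component of
    \<open>x\<close> that is \<open>B\<close>-orthogonal to \<open>y\<close>; the scaling avoids a
    division.\<close>
  have "0 \<le> (normB B (?b *\<^sub>R x + (- ?c) *\<^sub>R y))\<^sup>2" by simp
  also have "\<dots> = ?b * ((normB B x)\<^sup>2 * ?b - ?c\<^sup>2)"
    unfolding normB_combination[OF B] by (simp add: power2_eq_square algebra_simps)
  finally have "?c\<^sup>2 \<le> (normB B x * normB B y)\<^sup>2"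
    using b by (simp add: zero_le_mult_iff power_mult_distrib)
  then show ?thesis using B by (simp add: abs_le_square_iff[symmetric] abs_mult)
qed (simp add: normB_nonneg B)

text \<open>For \<open>v = cos \<phi> u + sin \<phi> e\<close> with \<open>e\<close> orthogonal to \<open>u\<close>, comparing coefficients in
  \<open>fejer_quadrature\<close> expresses \<open>A[v, u, \<dots>, u]\<close> as a combination of the diagonal values
  \<open>A[w k, \<dots>, w k]\<close>, \<open>w k = cos (\<theta> k) u + sin (\<theta> k) e\<close>, whose coefficients have absolute sum 1.\<close>

lemma polar_form_bound_unit:
  assumes B: "pos_def_selfadjoint B" and n: "n > 0" and A: "sym_multilinear n A"
    and M: "\<And>u. normB B u \<le> 1 \<Longrightarrow> \<bar>A (replicate n u)\<bar> \<le> M"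
    and u: "normB B u = 1" and v: "normB B v = 1"
  shows "\<bar>A (v # replicate (n - 1) u)\<bar> \<le> M"
proof -
  define c where "c = B u \<bullet> v"
  have c: "\<bar>c\<bar> \<le> 1" using normB_cauchy_schwarz[OF B, of u v] u v by (simp add: c_def)
  define \<phi> where "\<phi> = arccos c"
  have cos: "cos \<phi> = c" and sin: "sin \<phi> = sqrt (1 - c\<^sup>2)"
    using c by (auto simp: \<phi>_def sin_arccos abs_le_iff cos_arccos_abs)
  have sin2: "(sin \<phi>)\<^sup>2 = 1 - c\<^sup>2" using cos sin_squared_eq[of \<phi>] by simp
  \<comment> \<open>If \<open>sin \<phi> = 0\<close>, division by zero makes \<open>e\<close> the
    zero vector, and \<open>v = c *\<^sub>R u\<close> because the difference has norm 0. Hence the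
    norm of \<open>e\<close> is only bounded by 1 below.\<close>
  define e where "e = (1 / sin \<phi>) *\<^sub>R (v - c *\<^sub>R u)"
  have nvc: "(normB B (v - c *\<^sub>R u))\<^sup>2 = 1 - c\<^sup>2"
    using normB_combination[OF B, of 1 v "-c" u] u v pos_def_commute[OF B, of v u]
    by (simp add: c_def power2_eq_square)
  have vdec: "v = cos \<phi> *\<^sub>R u + sin \<phi> *\<^sub>R e"
  proof (cases "sin \<phi> = 0")
    case True
    then have "v - c *\<^sub>R u = 0" using nvc sin2 normB_eq_0_iff[OF B] by simp
    then show ?thesis using True cos by simp
  qed (simp add: e_def cos)
  have ne: "(normB B e)\<^sup>2 \<le> 1"
  proof -
    have "(normB B e)\<^sup>2 = (1 - c\<^sup>2) / (sin \<phi>)\<^sup>2"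
      unfolding e_def normB_scale[OF B] power_mult_distrib nvc by (simp add: power_divide)
    then show ?thesis by (simp add: sin2)
  qed
  have ue: "B u \<bullet> e = 0"
    using normB_power2[OF B, of u] u by (simp add: e_def inner_diff_right c_def)
  define \<theta> where "\<theta> k = (\<phi> + real k * pi) / real n" for k
  define w where "w k = cos (\<theta> k) *\<^sub>R u + sin (\<theta> k) *\<^sub>R e" for k
  have nw: "normB B (w k) \<le> 1" for k
  proof -
    have "(normB B (w k))\<^sup>2 = (cos (\<theta> k))\<^sup>2 + (sin (\<theta> k))\<^sup>2 * (normB B e)\<^sup>2"
      unfolding w_def normB_combination[OF B] by (simp add: u ue)
    also have "\<dots> \<le> (cos (\<theta> k))\<^sup>2 + (sin (\<theta> k))\<^sup>2 * 1"
      using ne by (intro add_left_mono mult_left_mono) auto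
    finally have "(normB B (w k))\<^sup>2 \<le> 1\<^sup>2" by simp
    then show ?thesis by (rule power2_le_imp_le) simp
  qed
  let ?a = "\<lambda>j. A (replicate (n - j) u @ replicate j e)"
  let ?d = "\<lambda>j. if j = 0 then cos \<phi> else if j = 1 then sin \<phi> else 0"
  have "A (v # replicate (n - 1) u) = cos \<phi> * A (u # replicate (n - 1) u) + sin \<phi> * A (e # replicate (n - 1) u)"
  proof -
    have "linear (\<lambda>v. A (v # replicate (n - 1) u))" using n by (intro sym_multilinear_linear[OF A]) simp
    from linear_add[OF this, of "cos \<phi> *\<^sub>R u" "sin \<phi> *\<^sub>R e"] linear_cmul[OF this] show ?thesis
      by (simp flip: vdec)
  qed
  also have "A (u # replicate (n - 1) u) = ?a 0"
    using n by (intro sym_multilinear_perm[OF A]) (auto simp: replicate_Suc[symmetric] simp del: replicate_Suc)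
  also have "A (e # replicate (n - 1) u) = ?a 1"
    using n by (intro sym_multilinear_perm[OF A]) auto
  also have "cos \<phi> * ?a 0 + sin \<phi> * ?a 1 = (\<Sum>j\<le>n. ?d j * ?a j)"
  proof -
    obtain m where m: "n = Suc m" using n by (cases n) auto
    have "(\<Sum>j\<le>n. ?d j * ?a j) = cos \<phi> * ?a 0 + (\<Sum>j\<le>m. ?d (Suc j) * ?a (Suc j))"
      unfolding m by (subst sum.atMost_Suc_shift) simp
    also have "(\<Sum>j\<le>m. ?d (Suc j) * ?a (Suc j)) = (\<Sum>j\<le>m. if j = 0 then sin \<phi> * ?a 1 else 0)"
      by (intro sum.cong) auto
    finally show ?thesis by (simp add: sum.delta)
  qed
  also have "\<dots> = (\<Sum>j\<le>n. \<Sum>k<n. (-1) ^ k * fejer_weight n \<phi> k *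
      (real (n choose j) * cos (\<theta> k) ^ (n - j) * sin (\<theta> k) ^ j) * ?a j)"
  proof (rule sum.cong[OF refl])
    fix j assume "j \<in> {..n}"
    then have "?d j = (\<Sum>k<n. (-1) ^ k * fejer_weight n \<phi> k *
      (real (n choose j) * cos (\<theta> k) ^ (n - j) * sin (\<theta> k) ^ j))"
      unfolding \<theta>_def using fejer_quadrature_coeffs[OF n, of j \<phi>] by simp
    then show "?d j * ?a j = (\<Sum>k<n. (-1) ^ k * fejer_weight n \<phi> k *
      (real (n choose j) * cos (\<theta> k) ^ (n - j) * sin (\<theta> k) ^ j) * ?a j)"
      by (simp only: sum_distrib_right)
  qed
  also have "\<dots> = (\<Sum>k<n. (-1) ^ k * fejer_weight n \<phi> k * A (replicate n (w k)))"
    unfolding w_def sym_multilinear_binomial[OF A]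
    by (subst sum.swap) (simp only: sum_distrib_left mult.assoc)
  finally have "\<bar>A (v # replicate (n - 1) u)\<bar> \<le> (\<Sum>k<n. \<bar>(-1) ^ k * fejer_weight n \<phi> k * A (replicate n (w k))\<bar>)"
    by (metis sum_abs)
  also have "\<dots> \<le> (\<Sum>k<n. fejer_weight n \<phi> k * M)"
    using M[OF nw] fejer_weight_nonneg
    by (intro sum_mono) (simp add: abs_mult power_abs mult_left_mono)
  also have "\<dots> = M" using sum_fejer_weight[OF n] by (simp flip: sum_distrib_right)
  finally show ?thesis .
qed

text \<open>Homogeneity in each argument reduces the bound to unit vectors.\<close>

lemma polar_form_bound:
  assumes B: "pos_def_selfadjoint B" and n: "n > 0" and A: "sym_multilinear n A"
    and M: "\<And>u. normB B u \<le> 1 \<Longrightarrow> \<bar>A (replicate n u)\<bar> \<le> M"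
  shows "\<bar>A (v # replicate (n - 1) u)\<bar> \<le> M * normB B u ^ (n - 1) * normB B v"
proof (cases "v = 0")
  case True
  have "linear (\<lambda>v. A (v # replicate (n - 1) u))" using n by (intro sym_multilinear_linear[OF A]) simp
  from linear_0[OF this] show ?thesis using True normB_eq_0_iff[OF B, of v] by simp
next
  case False
  have unit: "normB B ((1 / normB B x) *\<^sub>R x) = 1" and scl: "x = normB B x *\<^sub>R ((1 / normB B x) *\<^sub>R x)" if "x \<noteq> 0" for x
    using that normB_eq_0_iff[OF B, of x] by (auto simp: normB_scale[OF B] B)
  obtain v' where v': "normB B v' = 1" "v = normB B v *\<^sub>R v'" using unit scl False by blast
  obtain u' where u': "normB B u' = 1" "u = normB B u *\<^sub>R u'"
  proof (cases "u = 0")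
    case True
    \<comment> \<open>A zero vector has no direction of its own; any unit vector works, and
      \<open>v'\<close> is at hand.\<close>
    then show ?thesis using that[of v'] v'(1) normB_eq_0_iff[OF B, of u] by simp
  next
    case False
    then show ?thesis using that unit scl by blast
  qed
  have "linear (\<lambda>v. A (v # replicate (n - 1) u))" using n by (intro sym_multilinear_linear[OF A]) simp
  from linear_cmul[OF this, of "normB B v" v']
  have "A (v # replicate (n - 1) u) = normB B v * A (v' # replicate (n - 1) u)"
    by (simp flip: v'(2))
  also have "A (v' # replicate (n - 1) u) = normB B u ^ (n - 1) * A (v' # replicate (n - 1) u')"
    using sym_multilinear_replicate_scale[OF A, of "[v']" "n - 1" "[]" "normB B u" u'] n
    by (simp flip: u'(2))
  finally show ?thesis
    using mult_left_mono[OF polar_form_bound_unit[OF B n A M u'(1) v'(1)], of "normB B u ^ (n - 1) * normB B v"] B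
    by (simp add: abs_mult mult_ac)
qed

subsection \<open>Taylor estimates\<close>

text \<open>The induction hypothesis, applied to the shifted family, bounds the derivative
  \<open>\<phi> 1\<close>; integrating that bound from 0 raises the order by one.\<close>

lemma taylor_upper_bound:
  fixes \<phi> :: "nat \<Rightarrow> real \<Rightarrow> real"
  assumes "\<And>j t. j < m \<Longrightarrow> 0 \<le> t \<Longrightarrow> t \<le> 1 \<Longrightarrow> (\<phi> j has_real_derivative \<phi> (Suc j) t) (at t)"
    and "\<And>t. 0 \<le> t \<Longrightarrow> t \<le> 1 \<Longrightarrow> \<phi> m t - \<phi> m 0 \<le> C * t"
    and "0 \<le> s" "s \<le> 1"
  shows "\<phi> 0 s \<le> (\<Sum>j\<le>m. \<phi> j 0 * s ^ j / fact j) + C * s ^ Suc m / fact (Suc m)"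
  using assms
proof (induction m arbitrary: \<phi> s)
  case 0
  show ?case using "0.prems"(2)[of s] "0.prems"(3,4) by (simp add: algebra_simps)
next
  case (Suc m)
  \<comment> \<open>\<open>P\<close> is the antiderivative of the bound on \<open>\<phi> 1\<close>
    with initial value \<open>\<phi> 0 0\<close>, so \<open>P - \<phi> 0\<close> starts at 0 and is
    nondecreasing.\<close>
  define P where "P t = \<phi> 0 0 + (\<Sum>j\<le>m. \<phi> (Suc j) 0 * t ^ Suc j / fact (Suc j)) + C * t ^ Suc (Suc m) / fact (Suc (Suc m))" for t
  have pw: "((\<lambda>t. c * t ^ Suc j / fact (Suc j)) has_real_derivative c * t ^ j / fact j) (at t)" for c t :: real and j
  proof -
    have "((\<lambda>t. c * t ^ Suc j / fact (Suc j)) has_real_derivative c * (real (Suc j) * t ^ j) / fact (Suc j)) (at t)"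
      using DERIV_pow[of "Suc j" t] by (intro DERIV_cdivide DERIV_cmult) simp
    also have "c * (real (Suc j) * t ^ j) / fact (Suc j) = c * t ^ j / fact j"
      unfolding fact_Suc by (simp del: of_nat_Suc)
    finally show ?thesis .
  qed
  have "P 0 - \<phi> 0 0 \<le> P s - \<phi> 0 s"
  proof (rule DERIV_nonneg_imp_nondecreasing[OF \<open>0 \<le> s\<close>])
    fix t assume t: "0 \<le> t" "t \<le> s"
    then have t1: "t \<le> 1" using Suc.prems by simp
    have "\<phi> (Suc 0) t \<le> (\<Sum>j\<le>m. \<phi> (Suc j) 0 * t ^ j / fact j) + C * t ^ Suc m / fact (Suc m)"
      using Suc.IH[of "\<lambda>j. \<phi> (Suc j)" t] Suc.prems(1,2) t t1 by simp
    moreover have "((\<lambda>t. P t - \<phi> 0 t) has_real_derivative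
        (0 + (\<Sum>j\<le>m. \<phi> (Suc j) 0 * t ^ j / fact j) + C * t ^ Suc m / fact (Suc m)) - \<phi> (Suc 0) t) (at t)"
      unfolding P_def using Suc.prems(1)[of 0 t] t t1
      by (intro DERIV_diff DERIV_add DERIV_sum pw DERIV_const) auto
    ultimately show "\<exists>y. ((\<lambda>t. P t - \<phi> 0 t) has_real_derivative y) (at t) \<and> 0 \<le> y"
      by (intro exI conjI) auto
  qed
  moreover have "P 0 = \<phi> 0 0" by (simp add: P_def)
  ultimately have "\<phi> 0 s \<le> P s" by simp
  also have "P s = (\<Sum>j\<le>Suc m. \<phi> j 0 * s ^ j / fact j) + C * s ^ Suc (Suc m) / fact (Suc (Suc m))"
    unfolding P_def by (subst sum.atMost_Suc_shift) simp
  finally show ?case .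
qed

lemma taylor_lipschitz_bound:
  fixes \<phi> :: "nat \<Rightarrow> real \<Rightarrow> real"
  assumes d: "\<And>j t. j < m \<Longrightarrow> 0 \<le> t \<Longrightarrow> t \<le> 1 \<Longrightarrow> (\<phi> j has_real_derivative \<phi> (Suc j) t) (at t)"
    and L: "\<And>t. 0 \<le> t \<Longrightarrow> t \<le> 1 \<Longrightarrow> \<bar>\<phi> m t - \<phi> m 0\<bar> \<le> C * t"
  shows "\<bar>\<phi> 0 1 - (\<Sum>j\<le>m. \<phi> j 0 / fact j)\<bar> \<le> C / fact (Suc m)"
proof -
  have "\<phi> 0 1 \<le> (\<Sum>j\<le>m. \<phi> j 0 / fact j) + C / fact (Suc m)"
    using taylor_upper_bound[of m \<phi> C 1] d L by (simp add: abs_le_iff)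
  moreover have "- \<phi> 0 1 \<le> (\<Sum>j\<le>m. - \<phi> j 0 / fact j) + C / fact (Suc m)"
  proof -
    have "\<And>t. 0 \<le> t \<Longrightarrow> t \<le> 1 \<Longrightarrow> - \<phi> m t - - \<phi> m 0 \<le> C * t"
      using L by (fastforce simp: abs_le_iff)
    then show ?thesis
      using taylor_upper_bound[of m "\<lambda>j t. - \<phi> j t" C 1] d by (simp add: DERIV_minus)
  qed
  ultimately show ?thesis by (simp add: sum_negf abs_le_iff)
qed

lemma sym_multilinear_diff:
  assumes "sym_multilinear n A" "sym_multilinear n A'"
  shows "sym_multilinear n (\<lambda>us. A us - A' us)"
  unfolding sym_multilinear_def
proof (intro conjI allI impI)
  fix us :: "'a list" assume "Suc (length us) = n"
  then show "linear (\<lambda>v. A (v # us) - A' (v # us))"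
    using assms by (intro linear_compose_sub sym_multilinear_linear)
next
  fix us vs :: "'a list" assume "length us = n" "mset us = mset vs"
  then show "A us - A' us = A vs - A' vs"
    using sym_multilinear_perm[OF assms(1)] sym_multilinear_perm[OF assms(2)] by simp
qed

text \<open>The derivative of the Taylor polynomial at \<open>x\<close>, taken at \<open>y\<close> in direction \<open>v\<close>: the factor
  \<open>k\<close> from differentiating the \<open>k\<close>-th term turns \<open>1 / k!\<close> into \<open>1 / (k - 1)!\<close>, and \<open>j = k - 1\<close>.\<close>

definition taylor_diff ::
  "(nat \<Rightarrow> 'a::real_normed_vector \<Rightarrow> 'a list \<Rightarrow> real) \<Rightarrow> nat \<Rightarrow> 'a \<Rightarrow> 'a \<Rightarrow> 'a \<Rightarrow> real" where
  "taylor_diff D p x y v = (\<Sum>j<p. D (Suc j) x (v # replicate j (y - x)) / fact j)"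

lemma taylor_poly_derivative:
  assumes D: "deriv_tower f p D U" and U: "open U" "x \<in> U"
  shows "((\<lambda>t. taylor_poly f D p x (y + t *\<^sub>R v)) has_real_derivative taylor_diff D p x y v) (at 0)"
proof -
  have "((\<lambda>t. D k x (replicate k (y + t *\<^sub>R v - x)) / fact k) has_real_derivative
      (k * D k x (v # replicate (k - 1) (y - x))) / fact k) (at 0)" if "k \<in> {1..p}" for k
  proof -
    have "sym_multilinear k (D k x)" using that by (intro deriv_tower_sym_multilinear[OF D U(1)] U(2)) auto
    from sym_multilinear_replicate_derivative[OF this, of "y - x" v] show ?thesis
      using that by (intro DERIV_cdivide) (simp add: algebra_simps)
  qed
  then have "((\<lambda>t. taylor_poly f D p x (y + t *\<^sub>R v)) has_real_derivative
      0 + (\<Sum>k=1..p. (k * D k x (v # replicate (k - 1) (y - x))) / fact k)) (at 0)"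
    unfolding taylor_poly_def by (intro DERIV_add DERIV_const DERIV_sum) auto
  also have "(\<Sum>k=1..p. (k * D k x (v # replicate (k - 1) (y - x))) / fact k) = taylor_diff D p x y v"
    unfolding taylor_diff_def
    by (rule sum.reindex_bij_witness[of _ Suc "\<lambda>k. k - 1"]) (auto simp: fact_reduce)
  finally show ?thesis by simp
qed

text \<open>Taylor's theorem is applied to the derivative of \<open>f\<close> in direction
  \<open>v\<close> along the segment from \<open>x\<close> to \<open>y\<close>. The last derivative
  involves a mixed value of \<open>D p\<close>, and \<open>polar_form_bound\<close> for the
  difference of two such forms transfers the diagonal Lipschitz bound to it with the same
  constant.\<close>

lemma gradient_taylor_bound:
  assumes B: "pos_def_selfadjoint B" and p: "p > 0"
    and D: "deriv_tower f p D U" and U: "open U" and C: "convex C" "C \<subseteq> U"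
    and L: "L \<ge> 0"
    and Lip: "\<And>y z u. y \<in> C \<Longrightarrow> z \<in> C \<Longrightarrow> normB B u \<le> 1 \<Longrightarrow>
                \<bar>D p y (replicate p u) - D p z (replicate p u)\<bar> \<le> L * normB B (y - z)"
    and xy: "x \<in> C" "y \<in> C"
  shows "\<bar>D 1 y [v] - taylor_diff D p x y v\<bar> \<le> L / fact p * normB B (y - x) ^ p * normB B v"
proof -
  define \<gamma> where "\<gamma> t = x + t *\<^sub>R (y - x)" for t :: real
  define r where "r = normB B (y - x)"
  have \<gamma>C: "\<gamma> t \<in> C" if "0 \<le> t" "t \<le> 1" for t
    using convexD_alt[OF C(1) xy that] by (simp add: \<gamma>_def algebra_simps)
  then have \<gamma>U: "\<gamma> t \<in> U" if "0 \<le> t" "t \<le> 1" for t using that C by blast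
  \<comment> \<open>Differentiating along the segment prepends \<open>y - x\<close>, so keeping
    \<open>v\<close> at the end makes the derivative of \<open>\<phi> j\<close> literally
    \<open>\<phi> (Suc j)\<close>.\<close>
  define \<phi> where "\<phi> j t = D (Suc j) (\<gamma> t) (replicate j (y - x) @ [v])" for j t
  obtain m where m: "p = Suc m" using p by (cases p) auto
  have "\<bar>\<phi> 0 1 - (\<Sum>j\<le>m. \<phi> j 0 / fact j)\<bar> \<le> (L * r ^ p * normB B v) / fact (Suc m)"
  proof (rule taylor_lipschitz_bound)
    fix j and t :: real assume j: "j < m" and t: "0 \<le> t" "t \<le> 1"
    let ?us = "replicate j (y - x) @ [v]"
    have d: "((\<lambda>z. D (Suc j) z ?us) has_derivative (\<lambda>w. D (Suc (Suc j)) (\<gamma> t) (w # ?us))) (at (\<gamma> t))"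
      using deriv_tower_has_derivative[OF D _ \<gamma>U[OF t], of "Suc j" ?us] j m by simp
    have d\<gamma>: "(\<gamma> has_derivative (\<lambda>h. h *\<^sub>R (y - x))) (at t)"
      unfolding \<gamma>_def[abs_def] by (auto intro!: derivative_eq_intros)
    have "((\<lambda>s. D (Suc j) (\<gamma> s) ?us) has_derivative (\<lambda>h. D (Suc (Suc j)) (\<gamma> t) ((h *\<^sub>R (y - x)) # ?us))) (at t)"
      by (rule has_derivative_compose[of \<gamma> "\<lambda>h. h *\<^sub>R (y - x)" t UNIV "\<lambda>z. D (Suc j) z ?us", OF d\<gamma> d])
    moreover have "D (Suc (Suc j)) (\<gamma> t) ((h *\<^sub>R (y - x)) # ?us) = \<phi> (Suc j) t * h" for h
      using linear_cmul[OF has_derivative_linear[OF d], of h "y - x"] by (simp add: \<phi>_def)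
    moreover have "\<phi> j = (\<lambda>s. D (Suc j) (\<gamma> s) ?us)" by (simp add: \<phi>_def fun_eq_iff)
    ultimately show "(\<phi> j has_real_derivative \<phi> (Suc j) t) (at t)"
      unfolding has_field_derivative_def by simp
  next
    fix t :: real assume t: "0 \<le> t" "t \<le> 1"
    let ?A = "\<lambda>us. D p (\<gamma> t) us - D p x us"
    have A: "sym_multilinear p (D p (\<gamma> t))" "sym_multilinear p (D p x)"
      using deriv_tower_sym_multilinear[OF D U, of p] \<gamma>U[OF t] xy C by auto
    have "D p z (replicate m (y - x) @ [v]) = D p z (v # replicate m (y - x))" if "sym_multilinear p (D p z)" for z
      using m by (intro sym_multilinear_perm[OF that]) auto
    then have "\<phi> m t - \<phi> m 0 = ?A (v # replicate (p - 1) (y - x))"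
      using A m by (simp add: \<phi>_def \<gamma>_def[of 0])
    moreover have "\<bar>?A (v # replicate (p - 1) (y - x))\<bar> \<le> (L * (t * r)) * normB B (y - x) ^ (p - 1) * normB B v"
    proof (rule polar_form_bound[OF B p sym_multilinear_diff[OF A]])
      fix u assume "normB B u \<le> 1"
      then have "\<bar>?A (replicate p u)\<bar> \<le> L * normB B (\<gamma> t - x)" by (intro Lip \<gamma>C t xy)
      also have "normB B (\<gamma> t - x) = t * r" using normB_scale[OF B, of t "y - x"] t by (simp add: \<gamma>_def r_def)
      finally show "\<bar>?A (replicate p u)\<bar> \<le> L * (t * r)" .
    qed
    ultimately show "\<bar>\<phi> m t - \<phi> m 0\<bar> \<le> (L * r ^ p * normB B v) * t"
      by (simp add: m r_def mult_ac)
  qed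
  moreover have "\<phi> 0 1 = D 1 y [v]" by (simp add: \<phi>_def \<gamma>_def)
  moreover have "(\<Sum>j\<le>m. \<phi> j 0 / fact j) = taylor_diff D p x y v"
    unfolding taylor_diff_def m lessThan_Suc_atMost
  proof (intro sum.cong refl arg_cong[where f = "\<lambda>z. z / _"])
    fix j assume "j \<in> {..m}"
    then have "sym_multilinear (Suc j) (D (Suc j) x)"
      using m xy C by (intro deriv_tower_sym_multilinear[OF D U]) auto
    then show "\<phi> j 0 = D (Suc j) x (v # replicate j (y - x))"
      unfolding \<phi>_def by (simp add: \<gamma>_def) (erule sym_multilinear_perm, auto)
  qed
  ultimately show ?thesis by (simp add: m r_def)
qed

text \<open>Away from 0 this is the chain rule through the square root. At \<open>d = 0\<close> the
  norm itself is not differentiable, but the difference quotient of its power is of size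
  \<open>\<bar>t\<bar> ^ p\<close> and tends to 0.\<close>

lemma normB_power_derivative:
  assumes B: "pos_def_selfadjoint B" and p: "p > 0"
  shows "((\<lambda>t. normB B (d + t *\<^sub>R v) ^ (p + 1)) has_real_derivative
      real (p + 1) * normB B d ^ (p - 1) * (B d \<bullet> v)) (at 0)"
proof (cases "d = 0")
  case True
  have "((\<lambda>t. \<bar>t\<bar> ^ (p + 1)) has_real_derivative 0) (at 0)"
    unfolding has_field_derivative_iff
  proof -
    have "((\<lambda>t::real. \<bar>t\<bar> ^ p) \<longlongrightarrow> \<bar>0\<bar> ^ p) (at 0)" by (intro tendsto_intros)
    then have "((\<lambda>t::real. \<bar>t\<bar> ^ p) \<longlongrightarrow> 0) (at 0)" using p by (simp add: power_0_left)
    then have "((\<lambda>t::real. (\<bar>0 + t\<bar> ^ (p + 1) - \<bar>0\<bar> ^ (p + 1)) / t) \<longlongrightarrow> 0) (at 0)"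
      by (rule Lim_null_comparison[rotated]) (auto simp: eventually_at_filter abs_mult)
    then show "((\<lambda>t::real. (\<bar>t\<bar> ^ (p + 1) - \<bar>0\<bar> ^ (p + 1)) / (t - 0)) \<longlongrightarrow> 0) (at 0)" by simp
  qed
  then have "((\<lambda>t. \<bar>t\<bar> ^ (p + 1) * normB B v ^ (p + 1)) has_real_derivative 0 * normB B v ^ (p + 1)) (at 0)"
    by (rule DERIV_cmult_right)
  moreover have "B 0 = 0" using pos_def_linear[OF B] by (rule linear_0)
  ultimately show ?thesis using True by (simp add: normB_scale[OF B] power_mult_distrib mult_ac)
next
  case False
  have Bl: "linear B" using B by (rule pos_def_linear)
  let ?Q = "\<lambda>t. (normB B d)\<^sup>2 + 2 * t * (B d \<bullet> v) + t\<^sup>2 * (normB B v)\<^sup>2"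
  have r: "normB B d > 0" using False normB_eq_0_iff[OF B, of d] normB_nonneg[OF B, of d] by linarith
  have eq: "normB B (d + t *\<^sub>R v) = sqrt (?Q t)" for t
  proof -
    have "?Q t = (normB B (d + t *\<^sub>R v))\<^sup>2" using normB_combination[OF B, of 1 d t v] by simp
    then show ?thesis using B by simp
  qed
  have "(?Q has_real_derivative 2 * (B d \<bullet> v)) (at 0)"
    by (auto intro!: derivative_eq_intros)
  then have "((\<lambda>t. sqrt (?Q t)) has_real_derivative inverse (sqrt (?Q 0)) / 2 * (2 * (B d \<bullet> v))) (at 0)"
    using r by (intro DERIV_chain2[OF DERIV_real_sqrt]) auto
  then have "((\<lambda>t. sqrt (?Q t) ^ (p + 1)) has_real_derivative
      real (p + 1) * ((inverse (sqrt (?Q 0)) / 2 * (2 * (B d \<bullet> v))) * sqrt (?Q 0) ^ p)) (at 0)"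
    using DERIV_power[of "\<lambda>t. sqrt (?Q t)" _ 0 UNIV "p + 1"] by simp
  moreover have "sqrt (?Q 0) = normB B d" using B by simp
  moreover obtain m where "p = Suc m" using p by (cases p) auto
  ultimately show ?thesis unfolding eq using r by (simp add: field_simps)
qed

subsection \<open>Subgradients of convex functions\<close>

lemma ereal_on_edom:
  assumes "proper_closed_convex h" "y \<in> edom h"
  shows "h y = ereal (real_of_ereal (h y))"
  using assms unfolding proper_closed_convex_def edom_def by (cases "h y") auto

lemma convex_on_edom:
  assumes h: "proper_closed_convex h"
  shows "convex_on (edom h) (\<lambda>y. real_of_ereal (h y))" and "convex (edom h)"
proof -
  have ineq: "h ((1 - t) *\<^sub>R y + t *\<^sub>R z) \<le> ereal ((1 - t) * real_of_ereal (h y) + t * real_of_ereal (h z))"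
    if "y \<in> edom h" "z \<in> edom h" "0 \<le> t" "t \<le> 1" for y z t
  proof -
    have "h ((1 - t) *\<^sub>R y + t *\<^sub>R z) \<le> ereal (1 - t) * h y + ereal t * h z"
      using h that unfolding proper_closed_convex_def by blast
    also have "\<dots> = ereal (1 - t) * ereal (real_of_ereal (h y)) + ereal t * ereal (real_of_ereal (h z))"
      using ereal_on_edom[OF h] that by metis
    finally show ?thesis by simp
  qed
  have mem: "(1 - t) *\<^sub>R y + t *\<^sub>R z \<in> edom h"
    if "y \<in> edom h" "z \<in> edom h" "0 \<le> t" "t \<le> 1" for y z t
    using order_le_less_trans[OF ineq[OF that], of \<infinity>] by (simp add: edom_def)
  show c: "convex (edom h)"
    unfolding convex_alt using mem by blast
  show "convex_on (edom h) (\<lambda>y. real_of_ereal (h y))"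
  proof (rule convex_onI[OF _ c])
    fix t :: real and y z assume "0 < t" "t < 1" and yz: "y \<in> edom h" "z \<in> edom h"
    then have t: "0 \<le> t" "t \<le> 1" by simp_all
    show "real_of_ereal (h ((1 - t) *\<^sub>R y + t *\<^sub>R z)) \<le> (1 - t) * real_of_ereal (h y) + t * real_of_ereal (h z)"
      using ineq[OF yz t] ereal_on_edom[OF h mem[OF yz t]] by (metis ereal_less_eq(3))
  qed
qed

text \<open>On the segment from \<open>T\<close> to \<open>y\<close>, minimality and convexity of
  \<open>g\<close> bound \<open>g T - g y\<close> by the difference quotient of \<open>m\<close>;
  then \<open>t\<close> tends to 0 from the right.\<close>

lemma composite_minimizer_variation:
  fixes g :: "'a::real_normed_vector \<Rightarrow> real"
  assumes g: "convex_on C g" and TC: "T \<in> C" and yC: "y \<in> C"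
    and min: "\<And>z. z \<in> C \<Longrightarrow> m T + g T \<le> m z + g z"
    and d: "((\<lambda>t. m (T + t *\<^sub>R (y - T))) has_real_derivative m') (at 0)"
  shows "g y \<ge> g T - m'"
proof -
  have "((\<lambda>t. (m (T + t *\<^sub>R (y - T)) - m T) / t) \<longlongrightarrow> m') (at 0)"
    using d by (simp add: has_field_derivative_iff)
  then have lim: "((\<lambda>t. (m (T + t *\<^sub>R (y - T)) - m T) / t) \<longlongrightarrow> m') (at_right 0)"
    by (rule filterlim_mono) (auto simp: at_le)
  have "\<forall>\<^sub>F t::real in at_right 0. g T - g y \<le> (m (T + t *\<^sub>R (y - T)) - m T) / t"
    unfolding eventually_at_right_field
  proof (intro exI[of _ 1] conjI allI impI)
    fix t :: real assume t: "0 < t" "t < 1"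
    let ?z = "(1 - t) *\<^sub>R T + t *\<^sub>R y"
    have z: "T + t *\<^sub>R (y - T) = ?z" by (simp add: algebra_simps)
    have "g ?z \<le> (1 - t) * g T + t * g y"
      using convex_onD[OF g, of t T y] t TC yC by simp
    moreover have "?z \<in> C"
      using convex_on_imp_convex[OF g] t TC yC unfolding convex_alt by simp
    ultimately have "t * (g T - g y) \<le> m ?z - m T" using min[of ?z] by (simp add: algebra_simps)
    then show "g T - g y \<le> (m (T + t *\<^sub>R (y - T)) - m T) / t"
      unfolding z using t by (simp add: field_simps)
  qed simp
  then have "g T - g y \<le> m'" by (intro tendsto_lowerbound[OF lim]) auto
  then show ?thesis by simp
qed

text \<open>This is the variational inequality with \<open>m = - f\<close> and \<open>g = f\<close>:
  the sum is constantly 0, so every point minimizes it.\<close>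

lemma convex_gradient_inequality:
  fixes f :: "'a::real_normed_vector \<Rightarrow> real"
  assumes f: "convex_on U f" and x: "x \<in> U" and y: "y \<in> U"
    and d: "(f has_derivative f') (at x)"
  shows "f y \<ge> f x + f' (y - x)"
proof -
  have lin: "linear f'" using d by (rule has_derivative_linear)
  have "((\<lambda>t. f (x + t *\<^sub>R (y - x))) has_derivative (\<lambda>h. f' (h *\<^sub>R (y - x)))) (at 0)"
    by (rule has_derivative_compose[of "\<lambda>t. x + t *\<^sub>R (y - x)" "\<lambda>h. h *\<^sub>R (y - x)" 0 UNIV f f'])
      (use d in \<open>auto intro!: derivative_eq_intros\<close>)
  then have "((\<lambda>t. - f (x + t *\<^sub>R (y - x))) has_real_derivative - f' (y - x)) (at 0)"
    by (intro DERIV_minus) (simp add: has_field_derivative_def linear_cmul[OF lin] mult.commute[of _ "f' _"])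
  then have "f y \<ge> f x - - f' (y - x)"
    by (intro composite_minimizer_variation[OF f x y, where m = "\<lambda>z. - f z"]) auto
  then show ?thesis by simp
qed

text \<open>A hyperplane supporting the epigraph at \<open>(y, F y)\<close> is not vertical when
  \<open>y\<close> is relatively interior, so its normal can be rescaled to a subgradient.\<close>

lemma subgradient_exists_rel_interior:
  fixes F :: "'a::euclidean_space \<Rightarrow> real"
  assumes F: "convex_on C F" and y: "y \<in> rel_interior C"
  shows "\<exists>g. \<forall>z\<in>C. F z \<ge> F y + g \<bullet> (z - y)"
proof -
  have C: "convex C" using F by (rule convex_on_imp_convex)
  have yC: "y \<in> C" using y rel_interior_subset by blast
  let ?E = "epigraph C F"
  have E: "convex ?E" using F by (rule convex_epigraphI)
  \<comment> \<open>Otherwise the segment from \<open>(y, F y + 1)\<close> could be prolonged beyond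
    \<open>(y, F y)\<close>, to a point below the graph.\<close>
  have "(y, F y) \<notin> rel_interior ?E"
  proof
    assume "(y, F y) \<in> rel_interior ?E"
    moreover have "(y, F y + 1) \<in> ?E" using yC by (simp add: mem_epigraph)
    ultimately obtain e where "e > 1" "(1 - e) *\<^sub>R (y, F y + 1) + e *\<^sub>R (y, F y) \<in> ?E"
      using convex_rel_interior_iff[OF E] by (metis empty_iff)
    moreover have "(1 - e) *\<^sub>R (y, F y + 1) + e *\<^sub>R (y, F y) = (y, F y + (1 - e))"
      by (simp add: algebra_simps)
    ultimately show False by (simp add: mem_epigraph)
  qed
  moreover have yE: "(y, F y) \<in> ?E" using yC by (simp add: mem_epigraph)
  ultimately obtain a where
    a1: "\<And>w. w \<in> ?E \<Longrightarrow> a \<bullet> (y, F y) \<le> a \<bullet> w" and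
    a2: "\<And>w. w \<in> rel_interior ?E \<Longrightarrow> a \<bullet> (y, F y) < a \<bullet> w"
    using supporting_hyperplane_rel_boundary[OF E, of "(y, F y)"] by metis
  obtain u b where ab: "a = (u, b)" by (cases a)
  have ineq: "u \<bullet> y + b * F y \<le> u \<bullet> z + b * c" if "z \<in> C" "F z \<le> c" for z c
    using a1[of "(z, c)"] that by (simp add: ab mem_epigraph)
  have b0: "b \<ge> 0" using ineq[OF yC, of "F y + 1"] by (simp add: algebra_simps)
  \<comment> \<open>A vertical hyperplane would strictly separate \<open>y\<close> from some
    \<open>z\<close> in \<open>C\<close>, but the segment from \<open>z\<close> to \<open>y\<close>
    can be prolonged beyond \<open>y\<close> inside \<open>C\<close>, where the inequality
    reverses.\<close>
  have "b \<noteq> 0"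
  proof
    assume b: "b = 0"
    obtain w where w: "w \<in> rel_interior ?E" using rel_interior_eq_empty[OF E] yE by blast
    obtain z c where zc: "w = (z, c)" by (cases w)
    have zC: "z \<in> C" using w zc rel_interior_subset by (force simp: mem_epigraph)
    have lt: "u \<bullet> y < u \<bullet> z" using a2[OF w] by (simp add: ab zc b)
    obtain e where e: "e > 1" "(1 - e) *\<^sub>R z + e *\<^sub>R y \<in> C"
      using convex_rel_interior_iff[OF C, of y] y zC by blast
    have "u \<bullet> y \<le> u \<bullet> ((1 - e) *\<^sub>R z + e *\<^sub>R y)" using ineq[OF e(2) order_refl] b by simp
    then have "(e - 1) * (u \<bullet> z) \<le> (e - 1) * (u \<bullet> y)" by (simp add: inner_add_right algebra_simps)
    then show False using e(1) lt by simp
  qed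
  with b0 have b: "b > 0" by simp
  have "F z \<ge> F y + (- (1 / b) *\<^sub>R u) \<bullet> (z - y)" if "z \<in> C" for z
  proof -
    have "b * F y + u \<bullet> y - u \<bullet> z \<le> b * F z" using ineq[OF that order_refl] by simp
    then have "(b * F y + u \<bullet> y - u \<bullet> z) / b \<le> F z" using b by (simp add: field_simps)
    then show ?thesis using b by (simp add: inner_diff_right field_simps)
  qed
  then show ?thesis by blast
qed

section \<open>Growth from uniformly monotone subgradients\<close>

lemma powr_diff_le:
  fixes a b q :: real
  assumes "0 \<le> a" "a < b" "q \<ge> 1"
  shows "b powr q - a powr q \<le> q * b powr (q - 1) * (b - a)"
proof -
  have "\<exists>l z. a < z \<and> z < b \<and> DERIV (\<lambda>x. x powr q) z :> l \<and> b powr q - a powr q = (b - a) * l"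
  proof (rule MVT[OF \<open>a < b\<close>])
    show "continuous_on {a..b} (\<lambda>x. x powr q)"
      using assms by (intro continuous_on_powr' continuous_intros) auto
    show "(\<lambda>x. x powr q) differentiable (at x)" if "a < x" "x < b" for x
      using has_real_derivative_powr[of x q] that assms by (auto simp: real_differentiable_def)
  qed
  then obtain l z where z: "a < z" "z < b" "DERIV (\<lambda>x. x powr q) z :> l" "b powr q - a powr q = (b - a) * l"
    by blast
  have "l = q * z powr (q - 1)"
    using DERIV_unique[OF z(3) has_real_derivative_powr[of z q]] z assms by simp
  moreover have "z powr (q - 1) \<le> b powr (q - 1)" using z assms by (intro powr_mono2) auto
  ultimately have "l \<le> q * b powr (q - 1)" using assms by simp
  then have "(b - a) * l \<le> (b - a) * (q * b powr (q - 1))" using assms by (intro mult_left_mono) auto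
  then show ?thesis using z(4) by (simp add: mult_ac)
qed

text \<open>This integrates the slope bound through Riemann sums: after subtracting the
  antiderivative of the slope, the total error on a partition of mesh \<open>1 / n\<close> is at
  most \<open>K / n\<close>.\<close>

lemma growth_from_slopes:
  fixes \<phi> s :: "real \<Rightarrow> real"
  assumes slope: "\<And>a b. 0 \<le> a \<Longrightarrow> a < b \<Longrightarrow> b \<le> 1 \<Longrightarrow> \<phi> b - \<phi> a \<ge> (c + K * a powr (q - 1)) * (b - a)"
    and K: "K \<ge> 0" and q: "q > 1"
  shows "\<phi> 1 - \<phi> 0 \<ge> c + K / q"
proof -
  define \<psi> where "\<psi> t = \<phi> t - c * t - K / q * t powr q" for t
  have step: "\<psi> b - \<psi> a \<ge> - K * (b powr (q - 1) - a powr (q - 1)) * (b - a)"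
    if "0 \<le> a" "a < b" "b \<le> 1" for a b
  proof -
    have "K / q * (b powr q - a powr q) \<le> K / q * (q * b powr (q - 1) * (b - a))"
      using powr_diff_le[of a b q] that K q by (intro mult_left_mono) auto
    also have "\<dots> = K * b powr (q - 1) * (b - a)" using q by simp
    finally show ?thesis using slope[OF that] by (simp add: \<psi>_def algebra_simps)
  qed
  have bnd: "\<psi> 1 - \<psi> 0 \<ge> - K / real n" if n: "n > 0" for n
  proof -
    \<comment> \<open>The step errors are differences of \<open>t powr (q - 1)\<close> at
      neighbouring nodes and telescope; the term at 0 vanishes since
      \<open>0 powr (q - 1) = 0\<close>.\<close>
    have tele: "\<psi> (real k / n) - \<psi> 0 \<ge> - K * (real k / n) powr (q - 1) * (1 / n)" if "k \<le> n" for k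
      using that
    proof (induction k)
      case (Suc k)
      let ?a = "real k / n" and ?b = "real (Suc k) / n"
      have d: "?b - ?a = 1 / n" by (simp add: add_divide_distrib)
      have "?b \<le> 1" using Suc.prems n by simp
      moreover have "?a < ?b" using n by (simp add: divide_strict_right_mono)
      ultimately have "\<psi> ?b - \<psi> ?a \<ge> - K * (?b powr (q - 1) - ?a powr (q - 1)) * (1 / n)"
        using step[of ?a ?b] unfolding d by simp
      moreover have "\<psi> ?a - \<psi> 0 \<ge> - K * ?a powr (q - 1) * (1 / n)" using Suc by simp
      ultimately show ?case by (simp add: algebra_simps del: of_nat_Suc)
    qed simp
    show ?thesis using tele[of n] n by simp
  qed
  have ev: "\<forall>\<^sub>F n in sequentially. - K / real n \<le> \<psi> 1 - \<psi> 0"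
    by (rule eventually_mono[OF eventually_gt_at_top[of 0] bnd])
  have "(\<lambda>n. - K / real n) \<longlonglongrightarrow> 0" by (rule lim_const_over_n)
  then have "0 \<le> \<psi> 1 - \<psi> 0" using ev by (intro tendsto_upperbound) auto
  then show ?thesis by (simp add: \<psi>_def)
qed

text \<open>The real-valued counterpart of \<open>subdiff\<close>, tested on \<open>C\<close> only,
  so that the convexity arguments run without extended reals.\<close>

definition subgradient_on :: "('a::real_inner \<Rightarrow> real) \<Rightarrow> 'a set \<Rightarrow> 'a \<Rightarrow> 'a \<Rightarrow> bool" where
  "subgradient_on F C y g \<longleftrightarrow> (\<forall>z\<in>C. F z \<ge> F y + g \<bullet> (z - y))"

text \<open>All points of the segment except possibly \<open>T\<close> are relatively interior and
  hence have subgradients. Monotonicity against \<open>G\<close> bounds their slopes along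
  \<open>y - T\<close> from below, as \<open>growth_from_slopes\<close> requires.\<close>

lemma growth_rel_interior:
  fixes F :: "'a::euclidean_space \<Rightarrow> real"
  assumes B: "pos_def_selfadjoint B" and F: "convex_on C F" and T: "T \<in> C" and y: "y \<in> rel_interior C"
    and G: "subgradient_on F C T G"
    and mono: "\<And>y z Gy Gz. y \<in> C \<Longrightarrow> z \<in> C \<Longrightarrow> subgradient_on F C y Gy \<Longrightarrow> subgradient_on F C z Gz \<Longrightarrow>
        (Gy - Gz) \<bullet> (y - z) \<ge> \<sigma> * normB B (y - z) powr q"
    and \<sigma>: "\<sigma> > 0" and q: "q > 1"
  shows "F y \<ge> F T + G \<bullet> (y - T) + \<sigma> / q * normB B (y - T) powr q"
proof -
  let ?d = "y - T"
  have C: "convex C" using F by (rule convex_on_imp_convex)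
  define \<phi> where "\<phi> t = F (T + t *\<^sub>R ?d)" for t
  have ri: "T + t *\<^sub>R ?d \<in> rel_interior C" if "0 < t" "t \<le> 1" for t
    using rel_interior_convex_shrink[OF C y T that] by (simp add: algebra_simps)
  have "\<phi> 1 - \<phi> 0 \<ge> G \<bullet> ?d + (\<sigma> * normB B ?d powr q) / q"
  proof (rule growth_from_slopes[OF _ _ q])
    fix a b :: real assume ab: "0 \<le> a" "a < b" "b \<le> 1"
    have bC: "T + b *\<^sub>R ?d \<in> C" using ri[of b] ab rel_interior_subset by auto
    have ba: "(T + b *\<^sub>R ?d) - (T + a *\<^sub>R ?d) = (b - a) *\<^sub>R ?d" by (simp add: algebra_simps)
    show "(G \<bullet> ?d + \<sigma> * normB B ?d powr q * a powr (q - 1)) * (b - a) \<le> \<phi> b - \<phi> a"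
    proof (cases "a = 0")
      case True
      \<comment> \<open>At \<open>T\<close> itself the given \<open>G\<close> supplies the slope,
        and the extra term is zero because \<open>0 powr (q - 1) = 0\<close>.\<close>
      have "F T + G \<bullet> (T + b *\<^sub>R ?d - T) \<le> F (T + b *\<^sub>R ?d)"
        using G bC unfolding subgradient_on_def by blast
      then show ?thesis using True by (simp add: \<phi>_def mult.commute)
    next
      case False
      with ab have a: "0 < a" "a \<le> 1" by auto
      have aC: "T + a *\<^sub>R ?d \<in> C" using ri[OF a] rel_interior_subset by auto
      obtain Ga where Ga: "subgradient_on F C (T + a *\<^sub>R ?d) Ga"
        using subgradient_exists_rel_interior[OF F ri[OF a]] unfolding subgradient_on_def by blast
      have "\<sigma> * normB B (a *\<^sub>R ?d) powr q \<le> (Ga - G) \<bullet> (a *\<^sub>R ?d)"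
        using mono[OF aC T Ga G] by simp
      also have "normB B (a *\<^sub>R ?d) powr q = a * (a powr (q - 1) * normB B ?d powr q)"
        using a B powr_mult_base[of a "q - 1"] by (simp add: normB_scale powr_mult)
      finally have "a * (\<sigma> * normB B ?d powr q * a powr (q - 1)) \<le> a * (Ga \<bullet> ?d - G \<bullet> ?d)"
        by (simp add: inner_diff_left mult_ac)
      then have 1: "G \<bullet> ?d + \<sigma> * normB B ?d powr q * a powr (q - 1) \<le> Ga \<bullet> ?d"
        using a by simp
      have "F (T + a *\<^sub>R ?d) + Ga \<bullet> ((T + b *\<^sub>R ?d) - (T + a *\<^sub>R ?d)) \<le> F (T + b *\<^sub>R ?d)"
        using Ga bC unfolding subgradient_on_def by blast
      then have 2: "(Ga \<bullet> ?d) * (b - a) \<le> \<phi> b - \<phi> a" unfolding ba by (simp add: \<phi>_def mult.commute)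
      show ?thesis using mult_right_mono[OF 1, of "b - a"] 2 ab by linarith
    qed
  qed (use \<sigma> in simp)
  then show ?thesis by (simp add: \<phi>_def)
qed

text \<open>Subgradients may fail to exist on the relative boundary of \<open>C\<close>, so the growth estimate is
  first obtained at points of the relative interior and then extended along a segment.\<close>

lemma growth_of_uniformly_monotone_subgradients:
  fixes F :: "'a::euclidean_space \<Rightarrow> real"
  assumes B: "pos_def_selfadjoint B" and F: "convex_on C F" and T: "T \<in> C" and y: "y \<in> C"
    and G: "subgradient_on F C T G"
    and mono: "\<And>y z Gy Gz. y \<in> C \<Longrightarrow> z \<in> C \<Longrightarrow> subgradient_on F C y Gy \<Longrightarrow> subgradient_on F C z Gz \<Longrightarrow>
        (Gy - Gz) \<bullet> (y - z) \<ge> \<sigma> * normB B (y - z) powr q"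
    and \<sigma>: "\<sigma> > 0" and q: "q > 1"
  shows "F y \<ge> F T + G \<bullet> (y - T) + \<sigma> / q * normB B (y - T) powr q"
proof -
  have C: "convex C" using F by (rule convex_on_imp_convex)
  obtain z where z: "z \<in> rel_interior C" using rel_interior_eq_empty[OF C] y by blast
  then have zC: "z \<in> C" using rel_interior_subset by blast
  define y' where "y' e = (1 - e) *\<^sub>R y + e *\<^sub>R z" for e
  let ?l = "\<lambda>e. F T + G \<bullet> (y' e - T) + \<sigma> / q * normB B (y' e - T) powr q"
  let ?r = "\<lambda>e. (1 - e) * F y + e * F z"
  have "\<forall>\<^sub>F e in at_right 0. ?l e \<le> ?r e"
    unfolding eventually_at_right_field
  proof (intro exI[of _ 1] conjI allI impI)
    fix e :: real assume e: "0 < e" "e < 1"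
    have "y' e \<in> rel_interior C"
      using rel_interior_convex_shrink[OF C z y, of e] e by (simp add: y'_def algebra_simps)
    then have "?l e \<le> F (y' e)" by (rule growth_rel_interior[OF B F T _ G mono \<sigma> q])
    \<comment> \<open>\<open>F\<close> may be discontinuous at \<open>y\<close>; the chord
      \<open>?r e\<close> replaces \<open>F (y' e)\<close> and does converge to
      \<open>F y\<close>.\<close>
    also have "\<dots> \<le> ?r e" unfolding y'_def using convex_onD[OF F, of e y z] e y zC by simp
    finally show "?l e \<le> ?r e" .
  qed simp
  moreover have "(?r \<longlongrightarrow> F y) (at_right 0)"
  proof -
    have "(?r \<longlongrightarrow> (1 - 0) * F y + 0 * F z) (at_right 0)" by (intro tendsto_intros)
    then show ?thesis by simp
  qed
  moreover have "(?l \<longlongrightarrow> F T + G \<bullet> (y - T) + \<sigma> / q * normB B (y - T) powr q) (at_right 0)"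
  proof -
    have "((\<lambda>e. (1 - e) *\<^sub>R y + e *\<^sub>R z) \<longlongrightarrow> (1 - 0) *\<^sub>R y + 0 *\<^sub>R z) (at_right 0)" by (intro tendsto_intros)
    then have y': "(y' \<longlongrightarrow> y) (at_right 0)" unfolding y'_def[abs_def] by simp
    have bl: "bounded_linear B" using pos_def_linear[OF B] by (simp add: linear_conv_bounded_linear)
    note y'
    moreover have "((\<lambda>e. normB B (y' e - T)) \<longlongrightarrow> normB B (y - T)) (at_right 0)"
      unfolding normB_def by (intro tendsto_intros bounded_linear.tendsto[OF bl] y')
    ultimately show ?thesis using q B
      by (intro tendsto_intros tendsto_powr') auto
  qed
  ultimately show ?thesis by (intro tendsto_le[of "at_right 0" ?r "F y" ?l]) auto
qed

section \<open>Scalar estimates for the contraction constant\<close>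

text \<open>Young's inequality with exponents \<open>q\<close> and \<open>q / (q - 1)\<close>;
  splitting off \<open>\<sigma> powr (1 / q)\<close> makes the first Young term equal to the one
  subtracted.\<close>

lemma uniform_convexity_conjugate_bound:
  fixes K \<rho> :: real
  assumes q: "q > 1" and \<sigma>: "\<sigma> > 0" and "K \<ge> 0" "\<rho> \<ge> 0"
  shows "K * \<rho> - \<sigma> / q * \<rho> powr q \<le> (q - 1) / q * (1 / \<sigma>) powr (1 / (q - 1)) * K powr (q / (q - 1))"
proof -
  define a where "a = \<sigma> powr (1 / q) * \<rho>"
  define b where "b = \<sigma> powr (- (1 / q)) * K"
  have "a * b = \<sigma> powr (1 / q) * \<sigma> powr (- (1 / q)) * (K * \<rho>)" by (simp add: a_def b_def mult_ac)
  also have "\<sigma> powr (1 / q) * \<sigma> powr (- (1 / q)) = 1" using \<sigma> by (simp flip: powr_add)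
  finally have "K * \<rho> = a * b" by simp
  also have "\<dots> \<le> a powr q / q + b powr (q / (q - 1)) / (q / (q - 1))"
    using assms by (intro Youngs_inequality) (auto simp: a_def b_def field_simps)
  also have "a powr q = \<sigma> * \<rho> powr q"
    using assms by (simp add: a_def powr_mult powr_powr)
  also have "b powr (q / (q - 1)) = (1 / \<sigma>) powr (1 / (q - 1)) * K powr (q / (q - 1))"
    using assms by (simp add: b_def powr_mult powr_powr powr_minus powr_divide inverse_eq_divide)
  finally show ?thesis by (simp add: mult_ac)
qed

text \<open>Here \<open>\<delta>\<close> stands for the functional gap. The hypothesis gives
  \<open>r powr q \<le> (q / \<sigma>) * \<delta>\<close>; raising it to the power
  \<open>p / (q - 1)\<close> and collecting exponents of \<open>q\<close> and
  \<open>1 / \<sigma>\<close> yields the constant.\<close>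

lemma contraction_constant:
  fixes M r \<delta> q \<sigma> :: real
  assumes q: "q > 1" and \<sigma>: "\<sigma> > 0" and M: "M \<ge> 0" and r: "r \<ge> 0" and p: "p > 0"
    and \<delta>: "\<sigma> / q * r powr q \<le> \<delta>"
  shows "(q - 1) / q * (1 / \<sigma>) powr (1 / (q - 1)) * (M * r ^ p) powr (q / (q - 1))
    \<le> (q - 1) * q powr ((real p - q + 1) / (q - 1)) * (1 / \<sigma>) powr ((real p + 1) / (q - 1))
       * M powr (q / (q - 1)) * \<delta> powr (real p / (q - 1))"
proof -
  let ?s = "real p / (q - 1)"
  have "\<sigma> / q * r powr q \<ge> 0" using q \<sigma> by simp
  then have \<delta>0: "\<delta> \<ge> 0" using \<delta> by linarith
  \<comment> \<open>The case \<open>r = 0\<close> is separate because natural and real powers are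
    converted only for a positive base; both sides are then 0 as \<open>p > 0\<close>.\<close>
  have "(r ^ p) powr (q / (q - 1)) = (r powr q) powr ?s"
    using r p by (cases "r = 0") (auto simp: powr_powr mult.commute simp flip: powr_realpow)
  also have "\<dots> \<le> (q * (1 / \<sigma>) * \<delta>) powr ?s"
    using \<delta> q \<sigma> by (intro powr_mono2) (auto simp: field_simps)
  also have "\<dots> = q powr ?s * (1 / \<sigma>) powr ?s * \<delta> powr ?s"
    using q \<sigma> \<delta>0 by (simp add: powr_mult powr_divide)
  finally have "(q - 1) / q * (1 / \<sigma>) powr (1 / (q - 1)) * (M powr (q / (q - 1)) * (r ^ p) powr (q / (q - 1)))
     \<le> (q - 1) / q * (1 / \<sigma>) powr (1 / (q - 1)) * (M powr (q / (q - 1)) * (q powr ?s * (1 / \<sigma>) powr ?s * \<delta> powr ?s))"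
    using q by (intro mult_left_mono) auto
  also have "\<dots> = (q - 1) * (q powr ?s / q) * ((1 / \<sigma>) powr (1 / (q - 1)) * (1 / \<sigma>) powr ?s) * M powr (q / (q - 1)) * \<delta> powr ?s"
    by (simp add: mult_ac)
  also have "q powr ?s / q = q powr ((real p - q + 1) / (q - 1))"
  proof -
    have "(real p - q + 1) / (q - 1) = ?s - 1" using q by (simp add: field_simps)
    then show ?thesis using q by (simp add: powr_diff)
  qed
  also have "(1 / \<sigma>) powr (1 / (q - 1)) * (1 / \<sigma>) powr ?s = (1 / \<sigma>) powr ((real p + 1) / (q - 1))"
    by (simp add: add_divide_distrib add.commute flip: powr_add)
  finally show ?thesis using M r by (simp add: powr_mult)
qed

subsection \<open>The tensor step\<close>

lemma taylor_diff_linear: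
  assumes D: "deriv_tower f p D U" and U: "open U" "x \<in> U"
  shows "linear (taylor_diff D p x y)"
proof -
  have "linear (\<lambda>v. D (Suc j) x (v # replicate j (y - x)) / fact j)" if "j < p" for j
  proof -
    have "sym_multilinear (Suc j) (D (Suc j) x)"
      using that by (intro deriv_tower_sym_multilinear[OF D U(1)] U(2)) auto
    then have l: "linear (\<lambda>v. D (Suc j) x (v # replicate j (y - x)))" by (rule sym_multilinear_linear) simp
    show ?thesis
      by (intro linearI) (simp_all add: linear_add[OF l] linear_cmul[OF l] add_divide_distrib)
  qed
  then show ?thesis unfolding taylor_diff_def[abs_def] by (intro linear_compose_sum) auto
qed

text \<open>Outside \<open>edom h\<close> the function is infinite and the subgradient inequality is
  automatic.\<close>

lemma subdiff_iff_subgradient_on: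
  assumes h: "proper_closed_convex h" and y: "y \<in> edom h"
  shows "g \<in> subdiff (\<lambda>w. ereal (f w) + h w) y
    \<longleftrightarrow> subgradient_on (\<lambda>w. f w + real_of_ereal (h w)) (edom h) y g"
proof -
  have fin: "ereal (f w) + h w = ereal (f w + real_of_ereal (h w))" if "w \<in> edom h" for w
    by (subst ereal_on_edom[OF h that]) simp
  have inf: "ereal (f w) + h w = \<infinity>" if "w \<notin> edom h" for w
    using that by (simp add: edom_def)
  have "(ereal (f y) + h y) + ereal (g \<bullet> (w - y)) \<le> ereal (f w) + h w \<longleftrightarrow>
      (w \<in> edom h \<longrightarrow> f y + real_of_ereal (h y) + g \<bullet> (w - y) \<le> f w + real_of_ereal (h w))" for w
    by (cases "w \<in> edom h") (simp_all add: fin[OF y] fin inf)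
  then show ?thesis by (auto simp: subdiff_def subgradient_on_def fin[OF y])
qed

theorem theorem1:
  fixes B :: "'a::euclidean_space \<Rightarrow> 'a"
    and f :: "'a \<Rightarrow> real" and h :: "'a \<Rightarrow> ereal"
    and D :: "nat \<Rightarrow> 'a \<Rightarrow> 'a list \<Rightarrow> real"
    and U :: "'a set" and p :: nat and Lp H q \<sigma> :: real
    and x :: "nat \<Rightarrow> 'a"
  assumes B: "pos_def_selfadjoint B"
    and p: "p \<ge> 2"
    and h: "proper_closed_convex h"
    and U: "open U" "convex U" "edom h \<subseteq> U"
    and fconv: "convex_on U f"
    and Df: "deriv_tower f p D U"
    and Lp: "0 < Lp"
    and Lip: "\<forall>y\<in>edom h. \<forall>z\<in>edom h. \<forall>u. normB B u \<le> 1 \<longrightarrow>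
                \<bar>D p y (replicate p u) - D p z (replicate p u)\<bar> \<le> Lp * normB B (y - z)"
    and H: "H \<ge> real p * Lp"
    and q: "q \<ge> 2" and \<sigma>: "\<sigma> > 0"
    and unif: "\<forall>y\<in>edom h. \<forall>z\<in>edom h. \<forall>Gy Gz.
                 Gy \<in> subdiff (\<lambda>w. ereal (f w) + h w) y \<longrightarrow>
                 Gz \<in> subdiff (\<lambda>w. ereal (f w) + h w) z \<longrightarrow>
                 (Gy - Gz) \<bullet> (y - z) \<ge> \<sigma> * normB B (y - z) powr q"
    and x0: "x 0 \<in> edom h"
    and step: "\<forall>k. \<forall>y.
                 ereal (taylor_poly f D p (x k) (x (Suc k))
                        + H / fact (p + 1) * normB B (x (Suc k) - x k) ^ (p + 1)) + h (x (Suc k))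
                 \<le> ereal (taylor_poly f D p (x k) y
                        + H / fact (p + 1) * normB B (y - x k) ^ (p + 1)) + h y"
  shows "\<forall>k. let F = (\<lambda>w. f w + real_of_ereal (h w));
                  Fstar = (INF w\<in>edom h. F w) in
           F (x (Suc k)) - Fstar \<le>
             (q - 1) * q powr ((real p - q + 1) / (q - 1)) * (1 / \<sigma>) powr ((real p + 1) / (q - 1))
             * ((Lp + H) / fact p) powr (q / (q - 1)) * (F (x k) - Fstar) powr (real p / (q - 1))"
proof -
  define C where "C = edom h"
  define hr where "hr w = real_of_ereal (h w)" for w
  define F where "F w = f w + hr w" for w
  define m where "m X y = taylor_poly f D p X y + H / fact (p + 1) * normB B (y - X) ^ (p + 1)" for X y
  have hC: "h w = ereal (hr w)" if "w \<in> C" for w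
    using ereal_on_edom[OF h] that by (simp add: C_def hr_def)
  have convh: "convex_on C hr" and C: "convex C"
    using convex_on_edom[OF h] by (simp_all add: C_def hr_def[abs_def])
  have CU: "C \<subseteq> U" using U by (simp add: C_def)
  have convF: "convex_on C F"
    unfolding F_def[abs_def] by (intro convex_on_add convh convex_on_subset[OF fconv CU] C)
  have p0: "p > 0" using p by simp
  have q1: "q > 1" using q by simp
  \<comment> \<open>\<open>H \<ge> Lp\<close> lets the regularization dominate the Taylor error in
    \<open>Gdescent\<close>.\<close>
  have "1 * Lp \<le> real p * Lp" using Lp p by (intro mult_right_mono) auto
  with H have HL: "H \<ge> Lp" by simp
  \<comment> \<open>The subproblem has a finite value at \<open>x k\<close>, hence also at its
    minimizer.\<close>
  have xC: "x k \<in> C" for k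
  proof (induction k)
    case (Suc k)
    have "ereal (m (x k) (x (Suc k))) + h (x (Suc k)) \<le> ereal (m (x k) (x k)) + h (x k)"
      using step by (simp only: m_def)
    also have "\<dots> < \<infinity>" by (simp add: hC[OF Suc.IH])
    finally show ?case by (auto simp: C_def edom_def)
  qed (use x0 in \<open>simp add: C_def\<close>)
  have mono: "\<sigma> * normB B (y - z) powr q \<le> (Gy - Gz) \<bullet> (y - z)"
    if "y \<in> C" "z \<in> C" "subgradient_on F C y Gy" "subgradient_on F C z Gz" for y z Gy Gz
  proof -
    have "Gy \<in> subdiff (\<lambda>w. ereal (f w) + h w) y" "Gz \<in> subdiff (\<lambda>w. ereal (f w) + h w) z"
      using that subdiff_iff_subgradient_on[OF h, of y Gy f] subdiff_iff_subgradient_on[OF h, of z Gz f]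
      by (simp_all add: C_def F_def[abs_def] hr_def[abs_def])
    with unif that show ?thesis by (simp add: C_def)
  qed
  define Fstar where "Fstar = (INF w\<in>C. F w)"
  have main: "F (x (Suc k)) - Fstar \<le>
             (q - 1) * q powr ((real p - q + 1) / (q - 1)) * (1 / \<sigma>) powr ((real p + 1) / (q - 1))
             * ((Lp + H) / fact p) powr (q / (q - 1)) * (F (x k) - Fstar) powr (real p / (q - 1))" for k
  proof -
    define X T d r M where "X = x k" and "T = x (Suc k)" and "d = T - X" and "r = normB B d"
      and "M = (Lp + H) / fact p"
    have XC: "X \<in> C" and TC: "T \<in> C" using xC by (auto simp: X_def T_def)
    have XU: "X \<in> U" and TU: "T \<in> U" using XC TC CU by auto
    have r0: "r \<ge> 0" using B by (simp add: r_def)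
    have M0: "M \<ge> 0" using Lp HL by (simp add: M_def)
    have min: "m X T + hr T \<le> m X z + hr z" if "z \<in> C" for z
    proof -
      have "ereal (m X T) + h T \<le> ereal (m X z) + h z"
        using step by (simp only: m_def X_def T_def)
      then show ?thesis by (simp add: hC that TC)
    qed
    have rpow: "r ^ (p - 1) * r = r ^ p" using p0 by (metis power_minus_mult)
    \<comment> \<open>The derivative of the model at \<open>T\<close> in direction \<open>v\<close>;
      the factor \<open>p + 1\<close> from differentiating the power turns
      \<open>fact (p + 1)\<close> into \<open>fact p\<close>.\<close>
    define dm where "dm v = taylor_diff D p X T v + H / fact p * (r ^ (p - 1) * (B d \<bullet> v))" for v
    have dm: "((\<lambda>t. m X (T + t *\<^sub>R v)) has_real_derivative dm v) (at 0)" for v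
    proof -
      have "((\<lambda>t. normB B (d + t *\<^sub>R v) ^ (p + 1)) has_real_derivative real (p + 1) * r ^ (p - 1) * (B d \<bullet> v)) (at 0)"
        unfolding r_def by (rule normB_power_derivative[OF B p0])
      moreover have "(\<lambda>t. normB B (T + t *\<^sub>R v - X) ^ (p + 1)) = (\<lambda>t. normB B (d + t *\<^sub>R v) ^ (p + 1))"
        by (simp add: d_def algebra_simps)
      ultimately have dN: "((\<lambda>t. normB B (T + t *\<^sub>R v - X) ^ (p + 1)) has_real_derivative real (p + 1) * r ^ (p - 1) * (B d \<bullet> v)) (at 0)"
        by simp
      have "((\<lambda>t. m X (T + t *\<^sub>R v)) has_real_derivative taylor_diff D p X T v
          + H / fact (p + 1) * (real (p + 1) * r ^ (p - 1) * (B d \<bullet> v))) (at 0)"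
        unfolding m_def by (intro DERIV_add DERIV_cmult taylor_poly_derivative[OF Df U(1) XU] dN)
      also have "H / fact (p + 1) * (real (p + 1) * r ^ (p - 1) * (B d \<bullet> v)) = H / fact p * (r ^ (p - 1) * (B d \<bullet> v))"
      proof -
        have "H / (s * c) * (s * a * b) = H / c * (a * b)" if "s \<noteq> 0" for s a b c :: real
          using that by simp
        from this[of "real (p + 1)" "fact p"] show ?thesis by simp
      qed
      finally show ?thesis by (simp add: dm_def)
    qed
    have dT: "(f has_derivative (\<lambda>v. D 1 T [v])) (at T)"
    proof -
      have "((\<lambda>z. D 0 z []) has_derivative (\<lambda>v. D 1 T [v])) (at T)"
        using deriv_tower_has_derivative[OF Df p0 TU, of "[]"] by simp
      then show ?thesis
        by (rule has_derivative_transform_within_open[OF _ U(1) TU]) (use Df in \<open>simp add: deriv_tower_def\<close>)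
    qed
    define g where "g v = D 1 T [v] - dm v" for v
    have "linear dm"
      unfolding dm_def[abs_def]
      using linear_add[OF taylor_diff_linear[OF Df U(1) XU]] linear_cmul[OF taylor_diff_linear[OF Df U(1) XU]]
      by (intro linearI) (simp_all add: inner_add_right algebra_simps)
    then have "linear g"
      unfolding g_def[abs_def] using has_derivative_linear[OF dT] by (intro linear_compose_sub)
    \<comment> \<open>Applying the adjoint of the functional \<open>g\<close> to 1 gives its Riesz
      representative.\<close>
    define G where "G = adjoint g 1"
    have Gg: "G \<bullet> v = g v" for v
      using adjoint_works[OF \<open>linear g\<close>, of v 1] by (simp add: G_def inner_commute)
    have sub: "subgradient_on F C T G"
      unfolding subgradient_on_def
    proof
      fix y assume y: "y \<in> C"
      have "f y \<ge> f T + D 1 T [y - T]"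
        using y CU by (intro convex_gradient_inequality[OF fconv TU _ dT]) auto
      moreover have "hr y \<ge> hr T - dm (y - T)"
        by (rule composite_minimizer_variation[OF convh TC y min dm])
      ultimately show "F T + G \<bullet> (y - T) \<le> F y" by (simp add: F_def Gg g_def)
    qed
    have growth: "F y \<ge> F T + G \<bullet> (y - T) + \<sigma> / q * normB B (y - T) powr q" if "y \<in> C" for y
      by (rule growth_of_uniformly_monotone_subgradients[OF B convF TC that sub mono \<sigma> q1])
    have model: "\<bar>D 1 T [v] - taylor_diff D p X T v\<bar> \<le> Lp / fact p * r ^ p * normB B v" for v
      unfolding r_def d_def
      using Lip Lp by (intro gradient_taylor_bound[OF B p0 Df U(1) C CU _ _ XC TC]) (auto simp: C_def)
    have Gbound: "\<bar>G \<bullet> v\<bar> \<le> M * r ^ p * normB B v" for v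
    proof -
      have "\<bar>H / fact p * (r ^ (p - 1) * (B d \<bullet> v))\<bar> = H / fact p * (r ^ (p - 1) * \<bar>B d \<bullet> v\<bar>)"
        using r0 HL Lp by (simp add: abs_mult)
      also have "\<dots> \<le> H / fact p * (r ^ (p - 1) * (r * normB B v))"
        using normB_cauchy_schwarz[OF B, of d v] r0 HL Lp
        by (intro mult_left_mono) (auto simp: r_def)
      also have "\<dots> = H / fact p * r ^ p * normB B v" by (simp add: rpow[symmetric] mult_ac)
      finally have "\<bar>G \<bullet> v\<bar> \<le> Lp / fact p * r ^ p * normB B v + H / fact p * r ^ p * normB B v"
        using model[of v] unfolding Gg g_def dm_def by linarith
      then show ?thesis by (simp add: M_def add_divide_distrib distrib_right)
    qed
    \<comment> \<open>In the direction \<open>X - T = - d\<close> the regularizer contributes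
      \<open>H / fact p * r ^ (p + 1)\<close> to \<open>G\<close>, and the Taylor error is at most
      the same expression with \<open>Lp\<close>.\<close>
    have Gdescent: "G \<bullet> (X - T) \<ge> 0"
    proof -
      have XT: "X - T = - d" by (simp add: d_def)
      have "normB B (X - T) = r" unfolding r_def d_def by (rule normB_minus_commute[OF B])
      then have "\<bar>D 1 T [X - T] - taylor_diff D p X T (X - T)\<bar> \<le> Lp / fact p * (r ^ p * r)"
        using model[of "X - T"] by (simp add: mult.assoc)
      moreover have "B d \<bullet> (X - T) = - (r * r)"
        unfolding XT using normB_power2[OF B, of d] by (simp add: r_def power2_eq_square)
      then have "H / fact p * (r ^ (p - 1) * (B d \<bullet> (X - T))) = - (H / fact p * (r ^ p * r))"
        by (simp add: rpow[symmetric] mult_ac)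
      moreover have "Lp / fact p * (r ^ p * r) \<le> H / fact p * (r ^ p * r)"
        using HL r0 by (intro mult_right_mono divide_right_mono) auto
      ultimately show ?thesis unfolding Gg g_def dm_def by linarith
    qed
    let ?c = "(q - 1) / q * (1 / \<sigma>) powr (1 / (q - 1)) * (M * r ^ p) powr (q / (q - 1))"
    \<comment> \<open>Bounding \<open>G\<close> by its dual norm leaves a function of the distance
      \<open>?\<rho>\<close> alone; its bound \<open>?c\<close> is independent of \<open>y\<close>
      and so passes to the infimum.\<close>
    have lower: "F T - ?c \<le> F y" if y: "y \<in> C" for y
    proof -
      let ?\<rho> = "normB B (y - T)"
      have "F T - F y \<le> - (G \<bullet> (y - T)) - \<sigma> / q * ?\<rho> powr q" using growth[OF y] by simp
      also have "\<dots> \<le> (M * r ^ p) * ?\<rho> - \<sigma> / q * ?\<rho> powr q"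
        using Gbound[of "y - T"] by (simp add: abs_le_iff)
      also have "\<dots> \<le> ?c"
        using M0 r0 B by (intro uniform_convexity_conjugate_bound q1 \<sigma>) auto
      finally show ?thesis by simp
    qed
    \<comment> \<open>The real-valued infimum is meaningful only for a set bounded below, which
      \<open>lower\<close> provides.\<close>
    have "bdd_below (F ` C)" using lower by (intro bdd_belowI2)
    then have "Fstar \<le> F T" unfolding Fstar_def using TC by (intro cINF_lower)
    \<comment> \<open>Growth at \<open>y = X\<close>, with the inner product dropped by
      \<open>Gdescent\<close>.\<close>
    moreover have "\<sigma> / q * r powr q \<le> F X - F T"
      using growth[OF XC] Gdescent normB_minus_commute[OF B, of X T] by (simp add: r_def d_def)
    ultimately have \<delta>: "\<sigma> / q * r powr q \<le> F X - Fstar" by simp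
    have "F T - ?c \<le> Fstar"
      unfolding Fstar_def using lower TC by (intro cINF_greatest) auto
    then have "F T - Fstar \<le> ?c" by simp
    also have "\<dots> \<le> (q - 1) * q powr ((real p - q + 1) / (q - 1)) * (1 / \<sigma>) powr ((real p + 1) / (q - 1))
       * M powr (q / (q - 1)) * (F X - Fstar) powr (real p / (q - 1))"
      by (rule contraction_constant[OF q1 \<sigma> M0 r0 p0 \<delta>])
    finally show ?thesis by (simp add: X_def T_def M_def)
  qed
  then show ?thesis by (simp add: Let_def F_def Fstar_def hr_def C_def)
qed

end
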